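(* Let $d\ge 2$ be an integer, let $\varphi$ be the Laplace transform of a random variable $Z>0$, let $j\ge 0$ and $k\ge 1$ be integers, and let $\{H_\theta\}_{\theta\in\Theta}$ be a family of distribution functions on $\mathbf{R}^d$. Let $\theta\downarrow 0$ through a sequence $\{\theta_n\}\subset\Theta$, and suppose that $F$ is a distribution function on $\mathbf{R}^d$ with $$F=\lim_{\theta\to 0}\{H_\theta\}^j\,\varphi\!\left(\frac{1-\{H_\theta\}^k}{\theta}\right),$$ the limit being taken through $\{\theta_n\}$. Then $F$ is $\varphi$-MID if and only if there exist $\lambda\in[-\infty,\infty)^d$ and an exponent measure $\mu$ concentrating in $[\lambda,\infty]$ such that for $y\ge\lambda$ $$\frac{1-H_\theta(y)}{\theta}\to\mu([\lambda,y]^c)\quad\text{as }\theta\downarrow 0\text{ through }\{\theta_n\}.$$ In this case $F=\varphi(\mu)$, that is, $F(y)=\varphi\big(\mu([\lambda,y]^c)\big)$ for $y\ge\lambda$.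
   Context: $\Theta\subset(0,\infty)$ is a parameter set having $0$ as a limit point. The Laplace transform of $Z>0$ is $\varphi(v)=E(e^{-vZ})$, $v\ge 0$; conventions: $\varphi(\infty)=0$, $-\log 0=\infty$. Inequalities, intervals and operations on vectors are componentwise; $[\lambda,y]^c$ is the complement of $[\lambda,y]$ in $[\lambda,\infty]$. The discussion of a distribution function $F$ is with respect to the set $\{F>0\}=\{y\in\mathbf{R}^d:F(y)>0\}$. A distribution function $G$ on $\mathbf{R}^d$ is max-infinitely divisible (MID) if $G^{1/n}$ is a distribution function for every integer $n\ge 1$ (equivalently $G^t$ is one for all $t>0$). An exponent measure concentrating in $[\lambda,\infty]$ is a Radon measure $\mu$ on $[\lambda,\infty]\setminus\{\lambda\}$ such that $G(y)=\exp\{-\mu([\lambda,y]^c)\}$ for $y\ge\lambda$, $G(y)=0$ otherwise, defines a distribution function $G$ on $\mathbf{R}^d$ (values $\mu=\infty$ give $G=0$). Known fact: $G$ is MID if and only if it has this form for some $\lambda\in[-\infty,\infty)^d$ and some exponent measure $\mu$; here $\{G>0\}$ is a rectangle and $\lambda=\inf\{G>0\}$ is its bottom. For the fixed Laplace transform $\varphi$, a distribution function $F$ on $\mathbf{R}^d$ is called $\varphi$-MID if for every $\theta\in\Theta$ there exist a distribution function $H_\theta$ and a probability generating function (PGF) $P_\theta$ (of a non-negative integer valued random variable $N_\theta$ independent of the vectors having distribution function $H_\theta$) such that $P_\theta\{H_\theta\}\to F=\varphi\{-\log G\}$ as $\theta\downarrow 0$ through some sequence $\{\theta_n\}\subset\Theta$,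 where $G$ is a distribution function that is MID. For every $\theta>0$ the function $s\mapsto s^j\varphi((1-s^k)/\theta)$, $0<s<1$, is a PGF.
   Formalization: The last clause is corrected to F(y) = φ(k·μ([λ,y]^c)); the printed F = φ(μ) is right for k = 1 but fails for k ≥ 2, e.g. d=2, j=0, k=2, φ(v)=1/(1+v), H_θ=exp(−θ(e^{−y₁}+e^{−y₂})), where F=φ(2μ). *)

theory Defs
  imports "HOL-Probability.Probability"
begin

definition distribution_fun :: "(real^'d \<Rightarrow> real) \<Rightarrow> bool" where
  "distribution_fun F \<longleftrightarrow>
     (\<exists>M. prob_space M \<and> sets M = sets borel \<and> (\<forall>y. F y = measure M {x. x \<le> y}))"

definition max_inf_div :: "(real^'d \<Rightarrow> real) \<Rightarrow> bool" where
  "max_inf_div G \<longleftrightarrow> distribution_fun G \<and>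
     (\<forall>n\<ge>1. distribution_fun (\<lambda>y. G y powr (1 / real n)))"

text \<open>The Laplace transform of \<open>Z\<close>, extended to \<open>[0, \<infinity>]\<close> with value \<open>0\<close> at \<open>\<infinity>\<close>.\<close>

definition laplace_transform :: "'a measure \<Rightarrow> ('a \<Rightarrow> real) \<Rightarrow> ennreal \<Rightarrow> real" where
  "laplace_transform M Z v =
     (if v = \<infinity> then 0 else (\<integral>\<omega>. exp (- enn2real v * Z \<omega>) \<partial>M))"

text \<open>\<open>- log\<close> and \<open>exp (- _)\<close> between \<open>[0, 1]\<close> and \<open>[0, \<infinity>]\<close>.\<close>

definition neg_log :: "real \<Rightarrow> ennreal" where
  "neg_log x = (if x = 0 then \<infinity> else ennreal (- ln x))"

definition exp_neg :: "ennreal \<Rightarrow> real" where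
  "exp_neg v = (if v = \<infinity> then 0 else exp (- enn2real v))"

definition prob_gen_fun :: "(real \<Rightarrow> real) \<Rightarrow> bool" where
  "prob_gen_fun P \<longleftrightarrow>
     (\<exists>N :: nat pmf. \<forall>s\<in>{0..1}. P s = measure_pmf.expectation N (\<lambda>n. s ^ n))"

definition phi_max_inf_div :: "real set \<Rightarrow> (ennreal \<Rightarrow> real) \<Rightarrow> (real^'d \<Rightarrow> real) \<Rightarrow> bool" where
  "phi_max_inf_div \<Theta> \<phi> F \<longleftrightarrow> distribution_fun F \<and>
     (\<exists>H P G \<theta>.
        (\<forall>t\<in>\<Theta>. distribution_fun (H t) \<and> prob_gen_fun (P t)) \<and>
        max_inf_div G \<and>
        (\<forall>y. F y = \<phi> (neg_log (G y))) \<and>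
        range \<theta> \<subseteq> \<Theta> \<and> filterlim \<theta> (at_right 0) sequentially \<and>
        (\<forall>y. (\<lambda>n. P (\<theta> n) (H (\<theta> n) y)) \<longlonglongrightarrow> F y))"

definition ereal_vec :: "real^'d \<Rightarrow> ereal^'d" where
  "ereal_vec y = (\<chi> i. ereal (y $ i))"

text \<open>The complement of \<open>[l, y]\<close> in \<open>[l, \<infinity>]\<close>; the order on \<^typ>\<open>ereal^'d\<close> is componentwise.\<close>

definition rect_compl :: "ereal^'d \<Rightarrow> real^'d \<Rightarrow> (ereal^'d) set" where
  "rect_compl l y = {x. l \<le> x} - {x. l \<le> x \<and> x \<le> ereal_vec y}"

text \<open>\<open>[l, \<infinity>] - {l}\<close> is locally compact with a countable base, so a Radon measure on it is a
  Borel measure that is finite on its compact subsets.\<close>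

definition exponent_measure :: "ereal^'d \<Rightarrow> (ereal^'d) measure \<Rightarrow> bool" where
  "exponent_measure l \<mu> \<longleftrightarrow>
     sets \<mu> = sets (restrict_space borel ({x. l \<le> x} - {l})) \<and>
     (\<forall>K. compact K \<and> K \<subseteq> {x. l \<le> x} - {l} \<longrightarrow> emeasure \<mu> K < \<infinity>) \<and>
     distribution_fun
       (\<lambda>y. if l \<le> ereal_vec y then exp_neg (emeasure \<mu> (rect_compl l y)) else 0)"

end

theory Submission
  imports Defs
begin

text \<open>
  Since \<open>\<phi>\<close> is a strictly decreasing continuous bijection from \<open>[0, \<infinity>]\<close> to \<open>[0, 1]\<close>, convergence of
  \<open>H\<^sub>\<theta>\<^sup>j \<phi>((1 - H\<^sub>\<theta>\<^sup>k) / \<theta>)\<close> to \<open>F\<close> forces \<open>(1 - H\<^sub>\<theta>(y)) / \<theta>\<close> to converge in \<open>[0, \<infinity>]\<close> to some \<open>V(y)\<close>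
  with \<open>F = \<phi>(k V)\<close>, at every point \<open>y\<close>. Hence both sides of the equivalence hold outright:

  \<^item> \<open>exp(- \<tau> V)\<close> is the limit of the distribution functions \<open>H\<^sub>\<theta>\<close> raised to the power
    \<open>\<lfloor>\<tau> / \<theta>\<rfloor> + 1\<close>, so \<open>exp(- k V)\<close> is max-infinitely divisible and \<open>F\<close> is \<open>\<phi>\<close>-MID;

  \<^item> the measures \<open>\<theta>\<^sup>-\<^sup>1 H\<^sub>\<theta>\<close> converge on all complements of lower orthants, and their limit is an
    exponent measure with values \<open>V\<close>, whose bottom is \<open>l = inf {V < \<infinity>}\<close>.

  Both limits come from the Kolmogorov extension theorem: encode a point \<open>x\<close> by the 0-1 family of
  indicators of \<open>x \<le> c\<close> for rational \<open>c\<close>. Lower orthants are closed under intersection, so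
  inclusion-exclusion yields convergence of all finite-dimensional distributions of this family, and
  from the limiting 0-1 family \<open>b\<close> the point is recovered coordinatewise as the infimum of all \<open>c\<close>
  with \<open>b c = 1\<close>.
\<close>

subsection \<open>Orthants in a finite power of a linear order\<close>

text \<open>Boxes with sides from a countable basis form a countable family, and every open set of
  the product is a union of such boxes. Second countability of the components suffices, so the lemma
  applies to \<open>ereal^'d\<close> as well as to \<open>real^'d\<close>.\<close>

lemma borel_measurable_vec_componentwiseI:
  fixes f :: "'a \<Rightarrow> 'b::second_countable_topology ^ 'd"
  assumes "\<And>i. (\<lambda>x. f x $ i) \<in> borel_measurable M"
  shows "f \<in> borel_measurable M"
proof -
  obtain B :: "'b set set" where B: "countable B" "topological_basis B"
    using ex_countable_basis by blast
  define boxes where "boxes = (\<lambda>g. {x :: 'b^'d. \<forall>i. x $ i \<in> g i}) ` (PiE UNIV (\<lambda>_. B))"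
  have ctb: "countable boxes"
    unfolding boxes_def using B(1) by (intro countable_image countable_PiE) auto
  show ?thesis
  proof (rule borel_measurableI)
    fix S :: "('b^'d) set" assume "open S"
    have "S = \<Union>{b\<in>boxes. b \<subseteq> S}"
    proof (intro equalityI subsetI)
      fix x assume "x \<in> S"
      then obtain A where A: "\<And>i. open (A i)" "\<And>i. x $ i \<in> A i" "\<And>y. (\<forall>i. y $ i \<in> A i) \<Longrightarrow> y \<in> S"
        using \<open>open S\<close> unfolding open_vec_def by metis
      have "\<exists>b\<in>B. x $ i \<in> b \<and> b \<subseteq> A i" for i
        using topological_basisE[OF B(2) A(1) A(2)] by metis
      then obtain g where g: "\<And>i. g i \<in> B" "\<And>i. x $ i \<in> g i" "\<And>i. g i \<subseteq> A i" by metis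
      have "{x. \<forall>i. x $ i \<in> g i} \<subseteq> S" using A(3) g(3) by blast
      then have "{x. \<forall>i. x $ i \<in> g i} \<in> {b\<in>boxes. b \<subseteq> S}"
        unfolding boxes_def using g(1) by auto
      then show "x \<in> \<Union>{b\<in>boxes. b \<subseteq> S}" using g(2) by blast
    qed auto
    then have "f -` S \<inter> space M = (\<Union>b\<in>{b\<in>boxes. b \<subseteq> S}. f -` b \<inter> space M)" by blast
    also have "\<dots> \<in> sets M"
    proof (rule sets.countable_UN'')
      show "countable {b \<in> boxes. b \<subseteq> S}" using ctb by auto
      fix b assume "b \<in> {b\<in>boxes. b \<subseteq> S}"
      then obtain g where g: "\<And>i. g i \<in> B" and b: "b = {x. \<forall>i. x $ i \<in> g i}"
        unfolding boxes_def by (force simp: PiE_iff)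
      have "f -` b \<inter> space M = (\<Inter>i. (\<lambda>x. f x $ i) -` g i \<inter> space M)" by (auto simp: b)
      also have "\<dots> \<in> sets M"
        using topological_basis_open[OF B(2) g]
        by (intro sets.finite_INT) (auto intro!: measurable_sets[OF assms])
      finally show "f -` b \<inter> space M \<in> sets M" .
    qed
    finally show "f -` S \<inter> space M \<in> sets M" .
  qed
qed

lemma closed_vec_atMost: "closed {x :: 'b::linorder_topology ^ 'd. x \<le> a}"
proof -
  have "{x :: 'b^'d. x \<le> a} = (\<Inter>i. {x. x $ i \<le> a $ i})" by (auto simp: less_eq_vec_def)
  also have "closed \<dots>"
    by (intro closed_INT ballI closed_Collect_le continuous_intros)
  finally show ?thesis .
qed

lemma closed_vec_atLeast: "closed {x :: 'b::linorder_topology ^ 'd. a \<le> x}"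
proof -
  have "{x :: 'b^'d. a \<le> x} = (\<Inter>i. {x. a $ i \<le> x $ i})" by (auto simp: less_eq_vec_def)
  also have "closed \<dots>"
    by (intro closed_INT ballI closed_Collect_le continuous_intros)
  finally show ?thesis .
qed

lemma sets_borel_vec_atMost [measurable]: "{x :: 'b::linorder_topology ^ 'd. x \<le> a} \<in> sets borel"
  by (intro borel_closed closed_vec_atMost)

lemma sets_borel_vec_atLeast [measurable]: "{x :: 'b::linorder_topology ^ 'd. a \<le> x} \<in> sets borel"
  by (intro borel_closed closed_vec_atLeast)

lemma sets_borel_vec_not_atMost [measurable]:
  "{x :: 'b::linorder_topology ^ 'd. \<not> x \<le> a} \<in> sets borel"
  using borel_open[OF open_Compl[OF closed_vec_atMost[of a]]] by (simp add: Compl_eq)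

lemma sets_borel_vec_not_atLeast [measurable]:
  "{x :: 'b::linorder_topology ^ 'd. \<not> a \<le> x} \<in> sets borel"
  using borel_open[OF open_Compl[OF closed_vec_atLeast[of a]]] by (simp add: Compl_eq)

subsection \<open>Limit measures from converging orthant masses\<close>

text \<open>The random family is built by Kolmogorov extension from limits of finite-dimensional
  laws. The weights \<open>w n\<close> may grow while the mass of \<open>D\<close> vanishes;
  \<open>a {} = 1\<close> says that the rescaled mass of \<open>D\<close> tends to 1, so the limit
  is a probability.\<close>

lemma bit_vectors_limit:
  fixes N :: "nat \<Rightarrow> 'w measure" and w :: "nat \<Rightarrow> real" and B :: "'i \<Rightarrow> 'w set" and a :: "'i set \<Rightarrow> real"
  assumes prob: "\<And>n. prob_space (N n)" and w: "\<And>n. 0 \<le> w n"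
    and D: "\<And>n. D \<in> sets (N n)" and B: "\<And>n i. i \<in> I \<Longrightarrow> B i \<in> sets (N n)"
    and lim: "\<And>J. finite J \<Longrightarrow> J \<subseteq> I \<Longrightarrow> (\<lambda>n. w n * measure (N n) (D \<inter> {x. \<forall>i\<in>J. x \<in> B i})) \<longlonglongrightarrow> a J"
    and a1: "a {} = 1"
  obtains Q :: "('i \<Rightarrow> real) measure" where
    "prob_space Q" "sets Q = sets (PiM I (\<lambda>_. borel))"
    "\<And>J. finite J \<Longrightarrow> J \<subseteq> I \<Longrightarrow> measure Q {b \<in> space Q. \<forall>i\<in>J. b i = 1} = a J"
proof -
  interpret N: prob_space "N n" for n by (rule prob)
  define bits where "bits J x = (\<lambda>i\<in>J. indicator (B i) x :: real)" for J and x :: 'w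
  define cube where "cube J = PiE J (\<lambda>_::'i. {0, 1::real})" for J
  have cyl_sets: "D \<inter> {x. (\<forall>i\<in>S. x \<in> B i) \<and> (\<forall>i\<in>T. x \<notin> B i)} \<in> sets (N n)"
    if "finite S" "S \<subseteq> I" "finite T" "T \<subseteq> I" for S T n
    using that(3,4)
  proof (induction T)
    case empty
    show ?case using that(1,2)
    proof (induction S)
      case (insert i S)
      have *: "D \<inter> {x. (\<forall>j\<in>insert i S. x \<in> B j) \<and> (\<forall>i\<in>{}. x \<notin> B i)}
          = (D \<inter> {x. (\<forall>j\<in>S. x \<in> B j) \<and> (\<forall>i\<in>{}. x \<notin> B i)}) \<inter> B i" by auto
      show ?case unfolding * using insert by (intro sets.Int insert.IH B) auto
    qed (simp add: D)
  next
    case (insert i T)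
    have *: "D \<inter> {x. (\<forall>j\<in>S. x \<in> B j) \<and> (\<forall>j\<in>insert i T. x \<notin> B j)}
        = (D \<inter> {x. (\<forall>j\<in>S. x \<in> B j) \<and> (\<forall>j\<in>T. x \<notin> B j)}) - B i" by auto
    show ?case unfolding * using insert by (intro sets.Diff insert.IH B) auto
  qed
  \<comment> \<open>Inclusion-exclusion, one index at a time: requiring a point to avoid
    \<open>B i\<close> subtracts the mass of the cylinder with \<open>i\<close> moved into
    \<open>S\<close>. For this \<open>S\<close> has to vary in the induction on
    \<open>T\<close>.\<close>
  have cyl_conv: "convergent (\<lambda>n. w n * measure (N n) (D \<inter> {x. (\<forall>i\<in>S. x \<in> B i) \<and> (\<forall>i\<in>T. x \<notin> B i)}))"
    if "finite T" "T \<subseteq> I" "finite S" "S \<subseteq> I" for S T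
    using that
  proof (induction T arbitrary: S)
    case empty
    then show ?case using lim[of S] by (auto simp: convergent_def)
  next
    case (insert i T)
    let ?C = "\<lambda>S T. D \<inter> {x. (\<forall>i\<in>S. x \<in> B i) \<and> (\<forall>i\<in>T. x \<notin> B i)}"
    have "measure (N n) (?C S (insert i T)) = measure (N n) (?C S T) - measure (N n) (?C (insert i S) T)" for n
    proof -
      have *: "?C S (insert i T) = ?C S T - ?C (insert i S) T" by auto
      show ?thesis
        unfolding * using insert by (intro N.finite_measure_Diff cyl_sets) auto
    qed
    then have "(\<lambda>n. w n * measure (N n) (?C S (insert i T)))
        = (\<lambda>n. w n * measure (N n) (?C S T) - w n * measure (N n) (?C (insert i S) T))"
      by (simp add: right_diff_distrib)
    moreover have "convergent \<dots>"
      using insert by (intro convergent_diff insert.IH) auto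
    ultimately show ?case by simp
  qed
  have bits_cyl: "{x. bits J x = f} = {x. (\<forall>i\<in>{i\<in>J. f i = 1}. x \<in> B i) \<and> (\<forall>i\<in>{i\<in>J. f i \<noteq> 1}. x \<notin> B i)}"
    if "f \<in> cube J" for f J
  proof -
    have "bits J x = f \<longleftrightarrow> (\<forall>i\<in>J. indicator (B i) x = f i)" for x
      using that unfolding bits_def cube_def
      by (auto simp: fun_eq_iff restrict_def PiE_def extensional_def)
    then show ?thesis
      using that unfolding cube_def by (auto simp: indicator_def PiE_iff split: if_splits)
  qed
  have bits_cube: "bits J x \<in> cube J" for J x
    by (auto simp: bits_def cube_def indicator_def)
  have fin_cube: "finite (cube J)" if "finite J" for J
    unfolding cube_def using that by (intro finite_PiE) auto
  have bits_sets: "D \<inter> {x. bits J x = f} \<in> sets (N n)" if "finite J" "J \<subseteq> I" "f \<in> cube J" for J f n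
    unfolding bits_cyl[OF that(3)] using that by (intro cyl_sets) auto
  define p where "p J f = lim (\<lambda>n. w n * measure (N n) (D \<inter> {x. bits J x = f}))" for J f
  have p: "(\<lambda>n. w n * measure (N n) (D \<inter> {x. bits J x = f})) \<longlonglongrightarrow> p J f"
    if "finite J" "J \<subseteq> I" "f \<in> cube J" for J f
    unfolding p_def bits_cyl[OF that(3)] convergent_LIMSEQ_iff[symmetric]
    using that by (intro cyl_conv) auto
  have p_nonneg: "0 \<le> p J f" if "finite J" "J \<subseteq> I" "f \<in> cube J" for J f
    by (rule LIMSEQ_le_const[OF p[OF that]]) (auto intro!: exI mult_nonneg_nonneg w)
  \<comment> \<open>A discrete measure on the finite cube, transported by the identity to the
    product sigma-algebra. Bits are real numbers so that every coordinate space is Polish, as the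
    extension theorem requires.\<close>
  define P where "P J = distr (point_measure (cube J) (\<lambda>f. ennreal (p J f))) (PiM J (\<lambda>_. borel)) (\<lambda>f. f)" for J
  have cube_space: "cube J \<subseteq> space (PiM J (\<lambda>_. borel))" for J
    by (auto simp: cube_def space_PiM PiE_iff)
  have meas_id: "(\<lambda>f. f) \<in> measurable (point_measure (cube J) g) (PiM J (\<lambda>_. borel))" for J g
    using cube_space by (auto simp: measurable_def space_point_measure sets_point_measure)
  have P_emeasure: "emeasure (P J) A = ennreal (\<Sum>f\<in>cube J \<inter> A. p J f)"
    if "finite J" "J \<subseteq> I" "A \<in> sets (PiM J (\<lambda>_. borel))" for J A
  proof -
    have "emeasure (P J) A = emeasure (point_measure (cube J) (\<lambda>f. ennreal (p J f))) (A \<inter> cube J)"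
      unfolding P_def using that by (subst emeasure_distr[OF meas_id]) (auto simp: space_point_measure)
    also have "\<dots> = (\<Sum>f\<in>cube J \<inter> A. ennreal (p J f))"
      using fin_cube[OF that(1)] by (subst emeasure_point_measure_finite) (auto simp: Int_commute)
    also have "\<dots> = ennreal (\<Sum>f\<in>cube J \<inter> A. p J f)"
      using p_nonneg that by (intro sum_ennreal) auto
    finally show ?thesis .
  qed
  have P_lim: "(\<lambda>n. w n * measure (N n) (D \<inter> {x. bits J x \<in> A})) \<longlonglongrightarrow> (\<Sum>f\<in>cube J \<inter> A. p J f)"
    if J: "finite J" "J \<subseteq> I" for J A
  proof -
    have "measure (N n) (D \<inter> {x. bits J x \<in> A}) = (\<Sum>f\<in>cube J \<inter> A. measure (N n) (D \<inter> {x. bits J x = f}))" for n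
    proof -
      have "D \<inter> {x. bits J x \<in> A} = (\<Union>f\<in>cube J \<inter> A. D \<inter> {x. bits J x = f})"
        using bits_cube by auto
      also have "measure (N n) \<dots> = (\<Sum>f\<in>cube J \<inter> A. measure (N n) (D \<inter> {x. bits J x = f}))"
        using fin_cube J bits_sets by (intro N.finite_measure_finite_Union) (auto simp: disjoint_family_on_def)
      finally show ?thesis .
    qed
    then show ?thesis
      using J by (auto simp: sum_distrib_left intro!: tendsto_sum p)
  qed
  \<comment> \<open>Consistency needs no computation with \<open>p\<close>: \<open>bits J\<close> is
    the restriction of \<open>bits K\<close>, so the masses of \<open>A\<close> under
    \<open>P J\<close> and of its preimage under \<open>P K\<close> are limits of one and the same
    sequence.\<close>
  have proj: "projective_family I P (\<lambda>_. borel)"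
  proof (rule projective_family.intro)
    fix J K assume JK: "J \<subseteq> K" "finite K" "K \<subseteq> I"
    then have J: "finite J" "J \<subseteq> I" by (auto intro: finite_subset)
    show "P J = distr (P K) (PiM J (\<lambda>_. borel)) (\<lambda>f. restrict f J)"
    proof (rule measure_eqI)
      fix A assume "A \<in> sets (P J)"
      then have A: "A \<in> sets (PiM J (\<lambda>_. borel))" by (simp add: P_def)
      define A' where "A' = (\<lambda>f. restrict f J) -` A \<inter> space (PiM K (\<lambda>_. borel))"
      have mr: "(\<lambda>f. restrict f J) \<in> measurable (PiM K (\<lambda>_. borel::real measure)) (PiM J (\<lambda>_. borel))"
        using JK(1) by (rule measurable_restrict_subset)
      have A': "A' \<in> sets (PiM K (\<lambda>_. borel))"
        unfolding A'_def by (rule measurable_sets[OF mr A])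
      have "{x. bits J x \<in> A} = {x. bits K x \<in> A'}"
      proof -
        have "restrict (bits K x) J = bits J x" for x
          using JK(1) by (auto simp: bits_def fun_eq_iff restrict_def)
        moreover have "bits K x \<in> space (PiM K (\<lambda>_. borel))" for x
          using bits_cube cube_space by blast
        ultimately show ?thesis by (auto simp: A'_def)
      qed
      then have "(\<Sum>f\<in>cube J \<inter> A. p J f) = (\<Sum>f\<in>cube K \<inter> A'. p K f)"
        using LIMSEQ_unique[OF P_lim[OF J, of A]] P_lim[OF JK(2,3), of A'] by simp
      then have "emeasure (P J) A = emeasure (P K) A'"
        using P_emeasure[OF J A] P_emeasure[OF JK(2,3) A'] by simp
      also have "\<dots> = emeasure (distr (P K) (PiM J (\<lambda>_. borel)) (\<lambda>f. restrict f J)) A"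
        unfolding A'_def using mr A
        by (subst emeasure_distr) (auto simp: P_def)
      finally show "emeasure (P J) A = emeasure (distr (P K) (PiM J (\<lambda>_. borel)) (\<lambda>f. restrict f J)) A" .
    qed (simp add: P_def)
  next
    fix J assume J: "finite J" "J \<subseteq> I"
    have "(\<Sum>f\<in>cube J \<inter> space (PiM J (\<lambda>_. borel)). p J f) = 1"
    proof (rule LIMSEQ_unique[OF P_lim[OF J]])
      have "bits J x \<in> space (PiM J (\<lambda>_. borel))" for x
        using bits_cube cube_space by blast
      then show "(\<lambda>n. w n * measure (N n) (D \<inter> {x. bits J x \<in> space (PiM J (\<lambda>_. borel))})) \<longlonglongrightarrow> 1"
        using lim[of "{}"] by (simp add: a1)
    qed
    then show "prob_space (P J)"
      using P_emeasure[OF J sets.top] by (intro prob_spaceI) (simp add: P_def)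
  qed
  interpret projective_family I P "\<lambda>_. borel" by (rule proj)
  interpret polish_projective I P ..
  show ?thesis
  proof (rule that[of "projective_family.lim I P (\<lambda>_. borel)"])
    show "prob_space lim" by (rule P.prob_space_axioms)
    show "sets lim = sets (PiM I (\<lambda>_. borel))" by simp
    fix J assume J: "finite J" "J \<subseteq> I"
    define A where "A = {f \<in> extensional J. \<forall>i\<in>J. f i = (1::real)}"
    have A_PiE: "A = PiE J (\<lambda>_. {1})" unfolding A_def PiE_def Pi_def by auto
    have A: "A \<in> sets (PiM J (\<lambda>_. borel))"
      unfolding A_PiE using J by (intro sets_PiM_I_finite) auto
    have "{b \<in> space lim. \<forall>i\<in>J. b i = 1} = emb I J A"
      using J by (auto simp: A_def prod_emb_def space_PiM PiE_iff subset_iff extensional_def)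
    then have "emeasure lim {b \<in> space lim. \<forall>i\<in>J. b i = 1} = ennreal (\<Sum>f\<in>cube J \<inter> A. p J f)"
      using emeasure_lim_emb[OF J(2,1) A] P_emeasure[OF J A] by simp
    also have "(\<Sum>f\<in>cube J \<inter> A. p J f) = a J"
    proof (rule LIMSEQ_unique[OF P_lim[OF J]])
      have "{x. bits J x \<in> A} = {x. \<forall>i\<in>J. x \<in> B i}"
        by (auto simp: bits_def A_def indicator_def split: if_splits)
      then show "(\<lambda>n. w n * measure (N n) (D \<inter> {x. bits J x \<in> A})) \<longlonglongrightarrow> a J"
        using lim[OF J] by simp
    qed
    finally show "measure lim {b \<in> space lim. \<forall>i\<in>J. b i = 1} = a J"
      using LIMSEQ_le_const[OF lim[OF J], of 0] w
      by (auto simp: measure_def intro!: mult_nonneg_nonneg enn2real_ennreal)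
  qed
qed

section \<open>Approximation from the upper right and by rational points\<close>

text \<open>Right continuity is always tested along this one sequence. The shift is strictly
  positive in every coordinate, so it also moves a point on the boundary of a rectangle above
  \<open>l\<close> strictly into the interior.\<close>

definition right_shift :: "nat \<Rightarrow> real^'d \<Rightarrow> real^'d" where
  "right_shift n y = (\<chi> i. y $ i + 1 / real (Suc n))"

lemma right_shift_nth [simp]: "right_shift n y $ i = y $ i + 1 / real (Suc n)"
  by (simp add: right_shift_def)

lemma ereal_vec_nth [simp]: "ereal_vec y $ i = ereal (y $ i)"
  by (simp add: ereal_vec_def)

lemma ereal_vec_mono: "x \<le> y \<Longrightarrow> ereal_vec x \<le> ereal_vec y"
  by (auto simp: less_eq_vec_def)

lemma le_right_shift: "y \<le> right_shift n y"
  by (auto simp: less_eq_vec_def)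

lemma right_shift_tendsto: "(\<lambda>n. ereal (right_shift n y $ i)) \<longlonglongrightarrow> ereal (y $ i)"
proof -
  have "(\<lambda>n. y $ i + 1 / real (Suc n)) \<longlonglongrightarrow> y $ i + 0"
    by (intro tendsto_intros LIMSEQ_Suc lim_1_over_n)
  then show ?thesis by simp
qed

lemma le_ereal_vec_iff_right_shift:
  "x \<le> ereal_vec y \<longleftrightarrow> (\<forall>n. x \<le> ereal_vec (right_shift n y))"
proof
  assume "x \<le> ereal_vec y"
  then show "\<forall>n. x \<le> ereal_vec (right_shift n y)"
    using ereal_vec_mono[OF le_right_shift] order_trans by blast
next
  assume *: "\<forall>n. x \<le> ereal_vec (right_shift n y)"
  have "x $ i \<le> ereal_vec y $ i" for i
    using * by (intro LIMSEQ_le_const[OF right_shift_tendsto[of y i, folded ereal_vec_nth]])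
      (auto simp: less_eq_vec_def ereal_vec_def)
  then show "x \<le> ereal_vec y" by (simp add: less_eq_vec_def)
qed

lemma decseq_right_shift:
  assumes "m \<le> n" shows "right_shift n y \<le> right_shift m y"
  using assms by (auto simp: less_eq_vec_def intro!: frac_le)

lemma countable_rational_vec: "countable {c :: real^'d. \<forall>i. c $ i \<in> \<rat>}"
proof (rule countable_subset)
  show "{c :: real^'d. \<forall>i. c $ i \<in> \<rat>} \<subseteq> vec_lambda ` (PiE UNIV (\<lambda>_. \<rat>))"
  proof
    fix c :: "real^'d" assume "c \<in> {c. \<forall>i. c $ i \<in> \<rat>}"
    then show "c \<in> vec_lambda ` (PiE UNIV (\<lambda>_. \<rat>))"
      by (intro image_eqI[of _ _ "vec_nth c"]) auto
  qed
  show "countable (vec_lambda ` (PiE (UNIV :: 'd set) (\<lambda>_. \<rat> :: real set)))"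
    by (intro countable_image countable_PiE) (auto simp: countable_rat)
qed

text \<open>Extended real coordinates keep mass that escapes to infinity, so no tightness is
  required. The rational corners determine the limit law only up to an arbitrarily small shift;
  \<open>cont\<close> then gives the exact value at each corner strictly above
  \<open>l\<close>.\<close>

lemma limit_measure_ereal_vec:
  fixes N :: "nat \<Rightarrow> (real^'d) measure" and w :: "nat \<Rightarrow> real" and D :: "(real^'d) set"
    and l :: "ereal^'d" and a :: "real^'d \<Rightarrow> real"
  assumes prob: "\<And>n. prob_space (N n)" and sets_N: "\<And>n. sets (N n) = sets borel"
    and w: "\<And>n. 0 \<le> w n" and D: "D \<in> sets borel"
    and T: "(\<lambda>n. w n * measure (N n) D) \<longlonglongrightarrow> T" "0 < T"
    and a: "\<And>c. (\<And>i. l $ i < ereal (c $ i)) \<Longrightarrow> (\<lambda>n. w n * measure (N n) (D \<inter> {x. x \<le> c})) \<longlonglongrightarrow> a c"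
    and cont: "\<And>c. (\<And>i. l $ i < ereal (c $ i)) \<Longrightarrow> (\<lambda>n. a (right_shift n c)) \<longlonglongrightarrow> a c"
  obtains \<kappa> :: "(ereal^'d) measure" where
    "prob_space \<kappa>" "sets \<kappa> = sets borel" "AE x in \<kappa>. l \<le> x"
    "\<And>c. (\<And>i. l $ i < ereal (c $ i)) \<Longrightarrow> T * measure \<kappa> {x. x \<le> ereal_vec c} = a c"
proof -
  interpret N: prob_space "N n" for n by (rule prob)
  \<comment> \<open>Rational corners keep the infimum defining \<open>X\<close> and all almost-sure
    statements countable; only corners strictly above \<open>l\<close> have a known limit.\<close>
  define I where "I = {c :: real^'d. (\<forall>i. c $ i \<in> \<rat>) \<and> (\<forall>i. l $ i < ereal (c $ i))}"
  have ctI: "countable I"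
    by (rule countable_subset[OF _ countable_rational_vec]) (auto simp: I_def)
  \<comment> \<open>The intersection of the lower orthants at the points of \<open>J\<close> is the
    lower orthant at their meet, so \<open>a\<close> alone determines all joint probabilities of the
    bits.\<close>
  define mn where "mn J = (\<chi> i. Min ((\<lambda>c. c $ i) ` J))" for J :: "(real^'d) set"
  have le_mn: "x \<le> mn J \<longleftrightarrow> (\<forall>c\<in>J. x \<le> c)" if "finite J" "J \<noteq> {}" for J x
    using that by (auto simp: less_eq_vec_def mn_def)
  have l_mn: "l $ i < ereal (mn J $ i)" if "finite J" "J \<noteq> {}" "J \<subseteq> I" for J i
  proof -
    have "Min ((\<lambda>c. c $ i) ` J) \<in> (\<lambda>c. c $ i) ` J" using that by (intro Min_in) auto
    then show ?thesis using that(3) by (auto simp: mn_def I_def)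
  qed
  have a_mono: "a c \<le> a c'" if "\<And>i. l $ i < ereal (c $ i)" "c \<le> c'" for c c'
  proof -
    have l': "l $ i < ereal (c' $ i)" for i
      using that(1)[of i] that(2) by (auto simp: less_eq_vec_def intro: less_le_trans)
    have "measure (N n) (D \<inter> {x. x \<le> c}) \<le> measure (N n) (D \<inter> {x. x \<le> c'})" for n
      using that(2) D sets_N by (intro N.finite_measure_mono) (auto intro: order_trans)
    then show ?thesis
      by (intro LIMSEQ_le[OF a[OF that(1)] a[OF l']]) (auto intro!: exI mult_left_mono w)
  qed
  \<comment> \<open>The empty intersection is all of \<open>D\<close>, whose normalised mass is 1;
    \<open>mn {}\<close> has no meaning here.\<close>
  define A where "A J = (if J = {} then 1 else a (mn J) / T)" for J
  have A_lim: "(\<lambda>n. (w n / T) * measure (N n) (D \<inter> {x. \<forall>i\<in>J. x \<in> {x. x \<le> i}})) \<longlonglongrightarrow> A J"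
    if J: "finite J" "J \<subseteq> I" for J
  proof (cases "J = {}")
    case True
    then show ?thesis
      using tendsto_divide[OF T(1) tendsto_const[of T]] T(2) by (simp add: A_def)
  next
    case False
    show ?thesis
      using tendsto_divide[OF a[OF l_mn[OF J(1) False J(2)]] tendsto_const[of T]] T(2) False
      by (simp add: A_def le_mn[OF J(1) False, symmetric])
  qed
  obtain Q :: "(real^'d \<Rightarrow> real) measure" where Q: "prob_space Q" "sets Q = sets (PiM I (\<lambda>_. borel))"
    "\<And>J. finite J \<Longrightarrow> J \<subseteq> I \<Longrightarrow> measure Q {b \<in> space Q. \<forall>i\<in>J. b i = 1} = A J"
    by (rule bit_vectors_limit[of N "\<lambda>n. w n / T" D I "\<lambda>c. {x. x \<le> c}" A])
       (use prob w D T A_lim sets_N in \<open>auto simp: A_def\<close>)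
  interpret Q: prob_space Q by (rule Q(1))
  have comp [measurable]: "(\<lambda>b. b c) \<in> borel_measurable Q" if "c \<in> I" for c
    using measurable_component_singleton[OF that, of "\<lambda>_. borel"] measurable_cong_sets[OF Q(2) refl] by blast
  have bit_sets: "{b \<in> space Q. b c = 1} \<in> sets Q" if "c \<in> I" for c
    using comp[OF that] by measurable
  have bits_sets: "{b \<in> space Q. \<forall>s\<in>S. b s = 1} \<in> sets Q" if "finite S" "S \<subseteq> I" for S
    using that bit_sets by (intro sets.sets_Collect_finite_All) auto
  \<comment> \<open>A random 0-1 family \<open>b\<close> is almost surely of the form \<open>b c = indicator {..c} x\<close>, up to boundary
    effects, for the point \<open>x = X b\<close> below.\<close>
  have bits_imp: "AE b in Q. (\<forall>s\<in>S. b s = 1) \<longrightarrow> b c = 1"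
    if S: "finite S" "S \<noteq> {}" "S \<subseteq> I" and c: "c \<in> I" "mn S \<le> c" for S c
  proof -
    let ?E = "\<lambda>S. {b \<in> space Q. \<forall>s\<in>S. b s = 1}"
    have "x \<le> mn (insert c S) \<longleftrightarrow> x \<le> mn S" for x
    proof -
      have "x \<le> mn (insert c S) \<longleftrightarrow> x \<le> c \<and> x \<le> mn S"
        using S(1,2) by (subst (1 2) le_mn) auto
      then show ?thesis using c(2) order_trans by blast
    qed
    then have mn_eq: "mn (insert c S) = mn S" by (meson order_antisym order_refl)
    have "measure Q (?E S - ?E (insert c S)) = measure Q (?E S) - measure Q (?E (insert c S))"
      using S c by (intro Q.finite_measure_Diff bits_sets) auto
    also have "\<dots> = 0"
      using Q(3)[of S] Q(3)[of "insert c S"] S c by (simp add: A_def mn_eq)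
    finally have "?E S - ?E (insert c S) \<in> null_sets Q"
      using S c by (intro null_setsI sets.Diff bits_sets) (auto simp: Q.emeasure_eq_measure)
    then show ?thesis by (rule AE_I') auto
  qed
  \<comment> \<open>A corner with \<open>b c \<noteq> 1\<close> must not constrain the infimum,
    hence the value \<open>\<infinity>\<close>; a family without ones yields a point with all
    coordinates infinite.\<close>
  define val where "val b i c = (if b c = 1 then ereal (c $ i) else \<infinity>)" for b :: "real^'d \<Rightarrow> real" and i c
  define X where "X b = (\<chi> i. INF c\<in>I. val b i c)" for b
  have X_meas [measurable]: "X \<in> borel_measurable Q"
  proof (rule borel_measurable_vec_componentwiseI)
    fix i
    have "(\<lambda>b. INF c\<in>I. val b i c) \<in> borel_measurable Q"
      unfolding val_def using ctI bit_sets by (intro borel_measurable_INF measurable_If) auto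
    then show "(\<lambda>b. X b $ i) \<in> borel_measurable Q" by (simp add: X_def)
  qed
  have X_sets: "{b \<in> space Q. X b \<le> v} \<in> sets Q" for v
    using measurable_sets[OF X_meas sets_borel_vec_atMost[of v]]
    by (simp add: vimage_def Int_def conj_commute)
  have X_le: "X b \<le> ereal_vec c" if "c \<in> I" "b c = 1" for b c
  proof -
    have "(INF c\<in>I. val b i c) \<le> ereal (c $ i)" for i
      using that by (intro INF_lower2[of c]) (auto simp: val_def)
    then show ?thesis by (simp add: less_eq_vec_def X_def)
  qed
  have l_le_X: "l \<le> X b" for b
  proof -
    have "l $ i \<le> (INF c\<in>I. val b i c)" for i
      by (intro INF_greatest) (auto simp: val_def I_def intro: less_imp_le)
    then show ?thesis by (simp add: less_eq_vec_def X_def)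
  qed
  \<comment> \<open>A countable set has only countably many finite subsets, so a single null set
    serves all implications \<open>bits_imp\<close>.\<close>
  have "AE b in Q. \<forall>S\<in>{S. finite S \<and> S \<subseteq> I}. \<forall>c\<in>I. S \<noteq> {} \<longrightarrow> mn S \<le> c \<longrightarrow> (\<forall>s\<in>S. b s = 1) \<longrightarrow> b c = 1"
    using bits_imp ctI countable_Collect_finite_subset[OF ctI]
    by (intro AE_ball_countable[THEN iffD2] ballI AE_impI) (auto simp: conj_commute)
  \<comment> \<open>Each coordinate of the infimum supplies its own corner \<open>e i\<close> with
    bit 1 and \<open>e i $ i < c $ i\<close>. The meet of these finitely many corners lies below
    \<open>c\<close>, which forces \<open>b c = 1\<close>.\<close>
  then have X_le_imp: "AE b in Q. \<forall>y. \<forall>c\<in>I. (\<forall>i. y $ i < c $ i) \<longrightarrow> X b \<le> ereal_vec y \<longrightarrow> b c = 1"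
  proof eventually_elim
    case (elim b)
    show ?case
    proof (intro allI ballI impI)
      fix y c assume c: "c \<in> I" "\<forall>i. y $ i < c $ i" and le: "X b \<le> ereal_vec y"
      have "\<exists>e\<in>I. b e = 1 \<and> e $ i < c $ i" for i
      proof -
        have "(INF c\<in>I. val b i c) < ereal (c $ i)"
          using le c(2) by (auto simp: less_eq_vec_def X_def intro: le_less_trans)
        then obtain e where "e \<in> I" "val b i e < ereal (c $ i)"
          by (auto simp: INF_less_iff)
        then show ?thesis by (auto simp: val_def split: if_splits)
      qed
      then obtain e where e: "\<And>i. e i \<in> I" "\<And>i. b (e i) = 1" "\<And>i. e i $ i < c $ i" by metis
      have "mn (range e) \<le> c"
      proof -
        have "mn (range e) $ i \<le> e i $ i" for i by (auto simp: mn_def intro!: Min_le)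
        then show ?thesis using e(3) by (auto simp: less_eq_vec_def intro: le_less_trans[THEN less_imp_le])
      qed
      moreover have "range e \<in> {S. finite S \<and> S \<subseteq> I}" using e(1) by auto
      moreover have "\<forall>s\<in>range e. b s = 1" using e(2) by auto
      ultimately show "b c = 1" using bspec[OF bspec[OF elim, of "range e"] c(1)] by blast
    qed
  qed
  define \<kappa> where "\<kappa> = distr Q borel X"
  interpret K: prob_space \<kappa> unfolding \<kappa>_def by (rule Q.prob_space_distr) simp
  have K_eq: "measure \<kappa> {x. x \<le> ereal_vec y} = measure Q {b \<in> space Q. X b \<le> ereal_vec y}" for y
    unfolding \<kappa>_def by (subst measure_distr) (auto intro!: arg_cong[where f="measure Q"])
  show ?thesis
  proof (rule that[of \<kappa>])
    show "prob_space \<kappa>" by (rule K.prob_space_axioms)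
    show "sets \<kappa> = sets borel" by (simp add: \<kappa>_def)
    show "AE x in \<kappa>. l \<le> x" unfolding \<kappa>_def using l_le_X by (subst AE_distr_iff) auto
    fix y :: "real^'d" assume ly: "\<And>i. l $ i < ereal (y $ i)"
    \<comment> \<open>Rational corners between \<open>y\<close> and its shifts sandwich the mass at
      \<open>y\<close>: the bit at \<open>c n\<close> bounds it from above, and the mass at the
      shift is bounded from below by \<open>a y / T\<close>. Both bounds close up as the shift tends
      to 0.\<close>
    have "\<exists>c\<in>I. (\<forall>i. y $ i < c $ i) \<and> c \<le> right_shift n y" for n
    proof -
      have "\<exists>q\<in>\<rat>. y $ i < q \<and> q < y $ i + 1 / real (Suc n)" for i
        by (rule Rats_dense_in_real) auto
      then obtain q where q: "\<And>i. q i \<in> \<rat>" "\<And>i. y $ i < q i" "\<And>i. q i < y $ i + 1 / real (Suc n)" by metis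
      have "l $ i < ereal (q i)" for i using ly[of i] q(2)[of i] by (auto intro: less_trans)
      then show ?thesis
        using q by (intro bexI[of _ "vec_lambda q"]) (auto simp: I_def less_eq_vec_def intro: less_imp_le)
    qed
    then obtain c where c: "\<And>n. c n \<in> I" "\<And>n i. y $ i < c n $ i" "\<And>n. c n \<le> right_shift n y"
      by metis
    have lc: "l $ i < ereal (c n $ i)" for n i using c(1)[of n] by (auto simp: I_def)
    have mn1: "mn {x} = x" for x by (simp add: mn_def)
    have Qc: "measure Q {b \<in> space Q. b (c n) = 1} = a (c n) / T" for n
      using Q(3)[of "{c n}"] c(1) by (simp add: A_def mn1)
    have "measure \<kappa> {x. x \<le> ereal_vec y} \<le> a (right_shift n y) / T" for n
    proof -
      have "measure \<kappa> {x. x \<le> ereal_vec y} \<le> measure Q {b \<in> space Q. b (c n) = 1}"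
        unfolding K_eq using X_le_imp c(1)[of n] c(2)[of _ n] bit_sets
        by (intro Q.finite_measure_mono_AE) auto
      also have "\<dots> \<le> a (right_shift n y) / T"
        unfolding Qc using a_mono[OF lc c(3)] T(2) by (simp add: divide_right_mono)
      finally show ?thesis .
    qed
    then have up: "measure \<kappa> {x. x \<le> ereal_vec y} \<le> a y / T"
      using T(2) by (intro LIMSEQ_le_const[OF tendsto_divide[OF cont[OF ly] tendsto_const]]) auto
    have "a y / T \<le> measure \<kappa> {x. x \<le> ereal_vec (right_shift n y)}" for n
    proof -
      have "a y / T \<le> a (c n) / T"
        using a_mono[OF ly, of "c n"] c(2) T(2)
        by (auto simp: less_eq_vec_def divide_right_mono less_imp_le)
      also have "\<dots> \<le> measure \<kappa> {x. x \<le> ereal_vec (c n)}"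
        unfolding Qc[symmetric] K_eq using X_le[OF c(1)] X_sets by (intro Q.finite_measure_mono) auto
      also have "\<dots> \<le> measure \<kappa> {x. x \<le> ereal_vec (right_shift n y)}"
        using ereal_vec_mono[OF c(3)]
        by (intro K.finite_measure_mono) (auto simp: \<kappa>_def intro: order_trans)
      finally show ?thesis .
    qed
    moreover have "(\<lambda>n. measure \<kappa> {x. x \<le> ereal_vec (right_shift n y)}) \<longlonglongrightarrow> measure \<kappa> (\<Inter>n. {x. x \<le> ereal_vec (right_shift n y)})"
      using ereal_vec_mono[OF decseq_right_shift]
      by (intro K.finite_Lim_measure_decseq) (auto simp: \<kappa>_def decseq_def intro: order_trans)
    moreover have "(\<Inter>n. {x. x \<le> ereal_vec (right_shift n y)}) = {x. x \<le> ereal_vec y}"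
      by (subst le_ereal_vec_iff_right_shift) auto
    ultimately have "a y / T \<le> measure \<kappa> {x. x \<le> ereal_vec y}"
      by (intro LIMSEQ_le_const[where X="\<lambda>n. measure \<kappa> {x. x \<le> ereal_vec (right_shift n y)}"]) auto
    with up T(2) show "T * measure \<kappa> {x. x \<le> ereal_vec y} = a y"
      by (simp add: divide_simps mult.commute)
  qed
qed

section \<open>Distribution functions: limits and powers\<close>

text \<open>A limit law on the extended reals always exists. The hypothesis \<open>top\<close> keeps
  it away from \<open>\<infinity>\<close> in each coordinate and \<open>bot\<close> away from
  \<open>-\<infinity>\<close>, so it is carried by real vectors.\<close>

lemma distribution_fun_limit:
  fixes g :: "real^'d \<Rightarrow> real"
  assumes df: "\<And>n::nat. distribution_fun (h n)" and lim: "\<And>y. (\<lambda>n. h n y) \<longlonglongrightarrow> g y"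
    and cont: "\<And>y. (\<lambda>n. g (right_shift n y)) \<longlonglongrightarrow> g y"
    and top: "(\<lambda>n. g (\<chi> i. real n)) \<longlonglongrightarrow> 1"
    and bot: "\<And>y i. (\<lambda>n. g (\<chi> j. if j = i then - real n else y $ j)) \<longlonglongrightarrow> 0"
  shows "distribution_fun g"
proof -
  obtain N where N: "\<And>n. prob_space (N n)" "\<And>n. sets (N n) = sets borel"
    "\<And>n y. h n y = measure (N n) {x. x \<le> y}"
    using df unfolding distribution_fun_def by metis
  interpret N: prob_space "N n" for n by (rule N(1))
  define l where "l = (\<chi> i::'d. (-\<infinity> :: ereal))"
  obtain \<kappa> :: "(ereal^'d) measure" where K: "prob_space \<kappa>" "sets \<kappa> = sets borel"
    "\<And>c. (\<And>i. l $ i < ereal (c $ i)) \<Longrightarrow> 1 * measure \<kappa> {x. x \<le> ereal_vec c} = g c"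
  proof (rule limit_measure_ereal_vec[of N "\<lambda>_. 1" UNIV 1 l g])
    have "measure (N n) UNIV = 1" for n
      using N.prob_space[of n] sets_eq_imp_space_eq[OF N(2)[of n]] by simp
    then show "(\<lambda>n. 1 * measure (N n) UNIV) \<longlonglongrightarrow> 1" by simp
  qed (use N lim cont in auto)
  interpret K: prob_space \<kappa> by (rule K(1))
  have K_eq: "measure \<kappa> {x. x \<le> ereal_vec c} = g c" for c using K(3)[of c] by (simp add: l_def)
  have sp: "space \<kappa> = UNIV" using sets_eq_imp_space_eq[OF K(2)] by simp
  note [measurable_cong] = K(2)
  let ?v = "\<lambda>n. ereal_vec (\<chi> i::'d. real n)"
  have "AE x in \<kappa>. \<exists>n::nat. x \<le> ?v n"
  proof -
    let ?E = "\<Union>n. {x. x \<le> ?v n}"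
    have E: "?E \<in> sets \<kappa>" using K(2) by auto
    have "g (\<chi> i. real n) \<le> measure \<kappa> ?E" for n
      unfolding K_eq[symmetric] using E by (intro K.finite_measure_mono) auto
    then have "1 \<le> measure \<kappa> ?E" by (intro LIMSEQ_le_const2[OF top]) auto
    then have "measure \<kappa> ?E = 1" using K.prob_le_1[of ?E] by linarith
    then show ?thesis using K.prob_eq_1[OF E] by auto
  qed
  \<comment> \<open>The decay \<open>bot\<close> is available only with the other coordinates held
    fixed, so the event is first cut off at the level \<open>?v n\<close>.\<close>
  moreover have "AE x in \<kappa>. \<forall>i n. x \<le> ?v n \<longrightarrow> x $ i \<noteq> -\<infinity>"
  proof -
    have "AE x in \<kappa>. x \<le> ?v n \<longrightarrow> x $ i \<noteq> -\<infinity>" for n i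
    proof -
      let ?E = "{x. x \<le> ?v n \<and> x $ i = -\<infinity>}"
      have "?E = {x. x \<le> ?v n} \<inter> {x. x $ i = -\<infinity>}" by auto
      moreover have "closed {x :: ereal^'d. x $ i = -\<infinity>}"
        by (intro closed_Collect_eq continuous_intros)
      ultimately have E: "?E \<in> sets \<kappa>" using K(2) by auto
      have "measure \<kappa> ?E \<le> g (\<chi> j. if j = i then - real m else (\<chi> i. real n) $ j)" for m
      proof -
        have "?E \<subseteq> {x. x \<le> ereal_vec (\<chi> j. if j = i then - real m else real n)}"
          by (clarsimp simp: less_eq_vec_def)
        then have "measure \<kappa> ?E \<le> measure \<kappa> {x. x \<le> ereal_vec (\<chi> j. if j = i then - real m else real n)}"
          by (rule K.finite_measure_mono) (simp add: K(2))
        then show ?thesis by (simp add: K_eq cong: if_cong)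
      qed
      then have "measure \<kappa> ?E \<le> 0" by (intro LIMSEQ_le_const[OF bot[of i "\<chi> i. real n"]]) auto
      then have "?E \<in> null_sets \<kappa>"
        using E by (intro null_setsI) (auto simp: K.emeasure_eq_measure measure_le_0_iff)
      then show ?thesis by (rule AE_I') auto
    qed
    then show ?thesis by (intro AE_all_countable[THEN iffD2] allI)
  qed
  ultimately have fin: "AE x in \<kappa>. \<forall>i. \<bar>x $ i\<bar> \<noteq> \<infinity>"
  proof eventually_elim
    case (elim x)
    then obtain n where n: "x \<le> ?v n" by blast
    show ?case
    proof
      fix i
      have "x $ i \<le> ereal (real n)" using n by (auto simp: less_eq_vec_def)
      moreover have "x $ i \<noteq> -\<infinity>" using elim n by blast
      ultimately show "\<bar>x $ i\<bar> \<noteq> \<infinity>" by (cases "x $ i") auto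
    qed
  qed
  \<comment> \<open>Infinite coordinates are sent to 0 by \<open>real_of_ereal\<close>; by
    \<open>fin\<close> this happens only on a null set.\<close>
  define \<pi> where "\<pi> x = (\<chi> i. real_of_ereal (x $ i))" for x :: "ereal^'d"
  have nth_meas: "(\<lambda>x :: ereal^'d. x $ i) \<in> borel_measurable \<kappa>" for i
  proof -
    have "(\<lambda>x :: ereal^'d. x $ i) \<in> borel_measurable borel"
      by (intro borel_measurable_continuous_onI continuous_intros)
    then show ?thesis using measurable_cong_sets[OF K(2) refl] by blast
  qed
  have \<pi>_meas [measurable]: "\<pi> \<in> borel_measurable \<kappa>"
    using borel_measurable_real_of_ereal[OF nth_meas]
    by (intro borel_measurable_vec_componentwiseI) (simp add: \<pi>_def)
  have "measure (distr \<kappa> borel \<pi>) {x. x \<le> y} = g y" for y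
  proof -
    have "measure (distr \<kappa> borel \<pi>) {x. x \<le> y} = measure \<kappa> {x \<in> space \<kappa>. \<pi> x \<le> y}"
      by (subst measure_distr) (auto simp: sp intro!: arg_cong[where f="measure \<kappa>"])
    also have "\<dots> = measure \<kappa> {x. x \<le> ereal_vec y}"
    proof (rule K.finite_measure_eq_AE)
      show "AE x in \<kappa>. x \<in> {x \<in> space \<kappa>. \<pi> x \<le> y} \<longleftrightarrow> x \<in> {x. x \<le> ereal_vec y}"
        using fin
      proof eventually_elim
        case (elim x)
        then have "real_of_ereal (x $ i) \<le> y $ i \<longleftrightarrow> x $ i \<le> ereal (y $ i)" for i
          by (cases "x $ i") (auto dest: spec[of _ i])
        then show ?case by (simp add: sp \<pi>_def less_eq_vec_def)
      qed
      show "{x \<in> space \<kappa>. \<pi> x \<le> y} \<in> sets \<kappa>"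
        using measurable_sets[OF \<pi>_meas sets_borel_vec_atMost[of y]] by (simp add: vimage_def Int_def conj_commute)
    qed (simp add: K(2))
    finally show ?thesis by (simp add: K_eq)
  qed
  then show ?thesis
    unfolding distribution_fun_def
    by (intro exI[of _ "distr \<kappa> borel \<pi>"]) (auto intro: K.prob_space_distr)
qed

text \<open>The product is the distribution function of the componentwise maximum of two independent
  vectors.\<close>

lemma distribution_fun_mult:
  fixes f g :: "real^'d \<Rightarrow> real"
  assumes "distribution_fun f" "distribution_fun g"
  shows "distribution_fun (\<lambda>y. f y * g y)"
proof -
  obtain M N :: "(real^'d) measure" where
    M: "prob_space M" "sets M = sets borel" "\<And>y. f y = measure M {x. x \<le> y}" and
    N: "prob_space N" "sets N = sets borel" "\<And>y. g y = measure N {x. x \<le> y}"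
    using assms unfolding distribution_fun_def by metis
  interpret M: prob_space M by (rule M(1))
  interpret N: prob_space N by (rule N(1))
  interpret P: pair_prob_space M N ..
  note [measurable_cong] = M(2) N(2)
  define X where "X p = (\<chi> i. max (fst p $ i) (snd p $ i))" for p :: "(real^'d) \<times> (real^'d)"
  have nth: "(\<lambda>x :: real^'d. x $ i) \<in> borel_measurable borel" for i
    by (intro borel_measurable_continuous_onI continuous_intros)
  have X_meas: "X \<in> borel_measurable (M \<Otimes>\<^sub>M N)"
  proof (rule borel_measurable_vec_componentwiseI)
    fix i show "(\<lambda>x. X x $ i) \<in> borel_measurable (M \<Otimes>\<^sub>M N)"
      unfolding X_def vec_lambda_beta
      by (intro borel_measurable_max measurable_compose[OF _ nth]) measurable
  qed
  have "measure (distr (M \<Otimes>\<^sub>M N) borel X) {x. x \<le> y} = f y * g y" for y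
  proof -
    have "X -` {x. x \<le> y} \<inter> space (M \<Otimes>\<^sub>M N) = {x. x \<le> y} \<times> {x. x \<le> y}"
      using sets_eq_imp_space_eq[OF M(2)] sets_eq_imp_space_eq[OF N(2)]
      by (auto simp: X_def less_eq_vec_def space_pair_measure)
    then have "measure (distr (M \<Otimes>\<^sub>M N) borel X) {x. x \<le> y} = measure (M \<Otimes>\<^sub>M N) ({x. x \<le> y} \<times> {x. x \<le> y})"
      using X_meas by (subst measure_distr) auto
    also have "\<dots> = f y * g y"
      using M(2,3) N(2,3) by (simp add: measure_def N.emeasure_pair_measure_Times enn2real_mult)
    finally show ?thesis .
  qed
  then show ?thesis
    unfolding distribution_fun_def using X_meas
    by (intro exI[of _ "distr (M \<Otimes>\<^sub>M N) borel X"]) (auto intro: P.prob_space_distr)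
qed

lemma distribution_fun_power_Suc:
  assumes "distribution_fun f"
  shows "distribution_fun (\<lambda>y. f y ^ Suc n)"
proof (induction n)
  case (Suc n)
  show ?case using distribution_fun_mult[OF assms Suc] by simp
qed (use assms in simp)

section \<open>Construction of the exponent measure\<close>

text \<open>\<open>V y\<close> is the limiting rescaled mass outside the lower orthant at
  \<open>y\<close>. It is finite strictly above \<open>l\<close> and may be infinite elsewhere, so
  the measure is obtained as a countable sum of finite limits.\<close>

lemma exponent_measure_exists:
  fixes N :: "nat \<Rightarrow> (real^'d) measure" and w :: "nat \<Rightarrow> real" and V :: "real^'d \<Rightarrow> ennreal"
  assumes prob: "\<And>n. prob_space (N n)" and sets_N: "\<And>n. sets (N n) = sets borel"
    and w: "\<And>n. 0 \<le> w n"
    and V: "\<And>y. (\<lambda>n. ennreal (w n * (1 - measure (N n) {x. x \<le> y}))) \<longlonglongrightarrow> V y"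
    and cont: "\<And>y. (\<lambda>n. V (right_shift n y)) \<longlonglongrightarrow> V y"
    and fin: "V y0 < \<infinity>"
  obtains l :: "ereal^'d" and \<mu> :: "(ereal^'d) measure" where
    "\<And>i. l $ i < \<infinity>"
    "sets \<mu> = sets (restrict_space borel ({x. l \<le> x} - {l}))"
    "\<And>K. compact K \<Longrightarrow> K \<subseteq> {x. l \<le> x} - {l} \<Longrightarrow> emeasure \<mu> K < \<infinity>"
    "\<And>y. l \<le> ereal_vec y \<Longrightarrow> emeasure \<mu> (rect_compl l y) = V y"
    "\<And>y. \<not> l \<le> ereal_vec y \<Longrightarrow> V y = \<infinity>"
proof -
  interpret N: prob_space "N n" for n by (rule prob)
  have sp_N: "space (N n) = UNIV" for n using sets_eq_imp_space_eq[OF sets_N[of n]] by simp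
  have compl: "measure (N n) {x. \<not> x \<le> c} = 1 - measure (N n) {x. x \<le> c}" for n c
  proof -
    have "{x. \<not> x \<le> c} = space (N n) - {x. x \<le> c}" by (auto simp: sp_N)
    then show ?thesis by (simp add: N.prob_compl sets_N)
  qed
  have compl_sets: "{x. \<not> x \<le> c} \<in> sets (N n)" for n c
    by (simp add: sets_N)
  have V': "(\<lambda>n. ennreal (w n * measure (N n) {x. \<not> x \<le> y})) \<longlonglongrightarrow> V y" for y
    using V[of y] by (simp add: compl)
  have V_mono: "V c' \<le> V c" if "c \<le> c'" for c c'
  proof (rule LIMSEQ_le[OF V' V'])
    have "measure (N n) {x. \<not> x \<le> c'} \<le> measure (N n) {x. \<not> x \<le> c}" for n
      using that compl_sets by (intro N.finite_measure_mono) (auto intro: order_trans)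
    then show "\<exists>N'. \<forall>n\<ge>N'. ennreal (w n * measure (N n) {x. \<not> x \<le> c'}) \<le> ennreal (w n * measure (N n) {x. \<not> x \<le> c})"
      by (auto intro!: exI ennreal_leI mult_left_mono w)
  qed
  define v where "v c = enn2real (V c)" for c
  have v_lim: "(\<lambda>n. w n * measure (N n) {x. \<not> x \<le> c}) \<longlonglongrightarrow> v c" if "V c < \<infinity>" for c
  proof -
    have "(\<lambda>n. enn2real (ennreal (w n * measure (N n) {x. \<not> x \<le> c}))) \<longlonglongrightarrow> enn2real (ennreal (v c))"
      using V'[of c] that by (intro tendsto_enn2real) (auto simp: v_def)
    then show ?thesis by (simp add: w v_def)
  qed
  define l where "l = (\<chi> i. INF y\<in>{y. V y < \<infinity>}. ereal (y $ i))"
  have l_fin: "l $ i < \<infinity>" for i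
  proof -
    have "l $ i \<le> ereal (y0 $ i)" using fin by (auto simp: l_def intro!: INF_lower2[of y0])
    then show ?thesis by (rule le_less_trans) simp
  qed
  have V_inf: "V y = \<infinity>" if "\<not> l \<le> ereal_vec y" for y
  proof (rule ccontr)
    assume "V y \<noteq> \<infinity>"
    then have "l $ i \<le> ereal (y $ i)" for i
      by (auto simp: l_def less_top intro!: INF_lower2[of y])
    with that show False by (simp add: less_eq_vec_def)
  qed
  \<comment> \<open>Each coordinate has its own point \<open>z i\<close> of finite value with
    \<open>z i $ i < c $ i\<close>. A vector below all \<open>z i\<close> is below \<open>c\<close>,
    so a union bound gives finiteness at \<open>c\<close>: the set where \<open>V\<close> is finite
    contains the whole open rectangle above \<open>l\<close>.\<close>
  have V_fin: "V c < \<infinity>" if lc: "\<And>i. l $ i < ereal (c $ i)" for c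
  proof -
    have "\<exists>z. V z < \<infinity> \<and> z $ i < c $ i" for i
      using lc[of i] by (auto simp: l_def INF_less_iff)
    then obtain z where z: "\<And>i. V (z i) < \<infinity>" "\<And>i. z i $ i < c $ i" by metis
    have "measure (N n) {x. \<not> x \<le> c} \<le> (\<Sum>i\<in>UNIV. measure (N n) {x. \<not> x \<le> z i})" for n
    proof -
      have "x \<le> c" if "\<forall>i. x \<le> z i" for x
        unfolding less_eq_vec_def
      proof
        fix i have "x $ i \<le> z i $ i" using that by (simp add: less_eq_vec_def)
        then show "x $ i \<le> c $ i" using z(2)[of i] by simp
      qed
      then have "{x. \<not> x \<le> c} \<subseteq> (\<Union>i. {x. \<not> x \<le> z i})" by blast
      then have "measure (N n) {x. \<not> x \<le> c} \<le> measure (N n) (\<Union>i. {x. \<not> x \<le> z i})"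
        using compl_sets by (intro N.finite_measure_mono sets.finite_UN) auto
      also have "\<dots> \<le> (\<Sum>i\<in>UNIV. measure (N n) {x. \<not> x \<le> z i})"
        using compl_sets by (intro N.finite_measure_subadditive_finite) auto
      finally show ?thesis .
    qed
    then have "ennreal (w n * measure (N n) {x. \<not> x \<le> c}) \<le> ennreal (\<Sum>i\<in>UNIV. w n * measure (N n) {x. \<not> x \<le> z i})" for n
      unfolding sum_distrib_left[symmetric] by (intro ennreal_leI mult_left_mono w)
    moreover have "(\<lambda>n. ennreal (\<Sum>i\<in>UNIV. w n * measure (N n) {x. \<not> x \<le> z i})) \<longlonglongrightarrow> ennreal (\<Sum>i\<in>UNIV. v (z i))"
      by (intro tendsto_ennrealI tendsto_sum v_lim z(1))
    ultimately have "V c \<le> ennreal (\<Sum>i\<in>UNIV. v (z i))"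
      by (intro LIMSEQ_le[OF V']) auto
    then show ?thesis by (rule le_less_trans) simp
  qed
  have v_anti: "v c' \<le> v c" if "\<And>i. l $ i < ereal (c $ i)" "c \<le> c'" for c c'
    unfolding v_def using V_mono[OF that(2)] V_fin[OF that(1)] by (intro enn2real_mono) auto
  have l_shift: "l $ i < ereal (right_shift n y $ i)" if "l \<le> ereal_vec y" for n y i
  proof -
    have "l $ i \<le> ereal (y $ i)" using that by (simp add: less_eq_vec_def)
    also have "\<dots> < ereal (right_shift n y $ i)" by simp
    finally show ?thesis .
  qed
  have v_cont: "(\<lambda>n. v (right_shift n c)) \<longlonglongrightarrow> v c" if "\<And>i. l $ i < ereal (c $ i)" for c
    unfolding v_def using cont[of c] V_fin[OF that] by (intro tendsto_enn2real) auto
  \<comment> \<open>A sequence decreasing to \<open>l\<close> and strictly above it in every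
    coordinate; a coordinate \<open>-\<infinity>\<close> is approached through
    \<open>- real m\<close>.\<close>
  define yy where "yy m = (\<chi> i. if l $ i = -\<infinity> then - real m else real_of_ereal (l $ i) + 1 / real (Suc m))" for m
  have l_yy: "l $ i < ereal (yy m $ i)" for i m
    using l_fin[of i] by (cases "l $ i") (auto simp: yy_def)
  have yy_mono: "yy n \<le> yy m" if "m \<le> n" for m n
    using that by (auto simp: yy_def less_eq_vec_def intro!: frac_le)
  have yy_conv: "\<exists>m. ereal (yy m $ i) < x" if "l $ i < x" for i x
  proof (cases "l $ i")
    case (real r)
    have "(\<lambda>m. ereal (yy m $ i)) = (\<lambda>m. ereal (r + 1 / real (Suc m)))" by (simp add: yy_def real)
    also have "\<dots> \<longlonglongrightarrow> ereal (r + 0)"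
      by (intro tendsto_intros LIMSEQ_Suc lim_1_over_n)
    finally have "eventually (\<lambda>m. ereal (yy m $ i) < x) sequentially"
      using that real by (intro order_tendstoD(2)) auto
    then show ?thesis by (auto simp: eventually_sequentially)
  next
    case PInf
    then show ?thesis using that by auto
  next
    case MInf
    then have "-\<infinity> < x" using that by simp
    then obtain b where b: "ereal b < x" using ereal_dense2 by blast
    obtain m :: nat where "- b < real m" using reals_Archimedean2 by blast
    then have "ereal (yy m $ i) < ereal b" using MInf by (simp add: yy_def)
    with b show ?thesis by (intro exI[of _ m]) (rule less_trans)
  qed
  have yy_below: "\<exists>M. \<forall>m\<ge>M. yy m \<le> c" if "\<And>i. l $ i < ereal (c $ i)" for c
  proof -
    have "\<forall>i. \<exists>m. ereal (yy m $ i) < ereal (c $ i)" using yy_conv[OF that] by blast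
    then obtain m where m: "\<And>i. ereal (yy (m i) $ i) < ereal (c $ i)" by metis
    show ?thesis
    proof (intro exI allI impI)
      fix n assume n: "Max (range m) \<le> n"
      have "yy n $ i \<le> c $ i" for i
      proof -
        have "m i \<le> n" using n by (meson Max_ge finite_imageI finite order_trans rangeI)
        then have "yy n $ i \<le> yy (m i) $ i" using yy_mono by (simp add: less_eq_vec_def)
        then show ?thesis using m[of i] by simp
      qed
      then show "yy n \<le> c" by (simp add: less_eq_vec_def)
    qed
  qed
  \<comment> \<open>Meeting \<open>c\<close> with \<open>yy m\<close> expresses the part of
    \<open>{x. x \<le> c}\<close> outside the orthant at \<open>yy m\<close> as a difference of two
    complements of orthants, whose limiting masses are known.\<close>
  define mc where "mc m c = (\<chi> i. min (yy m $ i) (c $ i))" for m and c :: "real^'d"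
  have l_mc: "l $ i < ereal (mc m c $ i)" if "\<And>i. l $ i < ereal (c $ i)" for i m c
    using that[of i] l_yy[of i m] by (auto simp: mc_def min_def)
  have le_mc: "x \<le> mc m c \<longleftrightarrow> x \<le> yy m \<and> x \<le> c" for x m c
    by (auto simp: less_eq_vec_def mc_def)
  \<comment> \<open>The measure may be infinite near \<open>l\<close>, so it is assembled from the finite limits over the shells
    \<open>U (Suc m) - U m\<close>.\<close>
  define U where "U m = (case m of 0 \<Rightarrow> {} | Suc m \<Rightarrow> {x. \<not> x \<le> yy m})" for m
  have U_sets: "U m \<in> sets (N n)" for m n
    using compl_sets by (auto simp: U_def split: nat.split)
  have U_mono: "U m \<subseteq> U (Suc m)" for m
    using yy_mono[of "m - 1" m] by (auto simp: U_def split: nat.split intro: order_trans)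
  \<comment> \<open>\<open>t m\<close> and \<open>u m c\<close> are the limiting masses of
    \<open>U m\<close> and of its part below \<open>c\<close>. Both vanish at index 0, where
    \<open>U\<close> is empty, so the later sums telescope from 0.\<close>
  define t where "t m = (case m of 0 \<Rightarrow> 0 | Suc m \<Rightarrow> v (yy m))" for m
  define u where "u m c = (case m of 0 \<Rightarrow> 0 | Suc m \<Rightarrow> v (mc m c) - v c)" for m c
  have t_lim: "(\<lambda>n. w n * measure (N n) (U m)) \<longlonglongrightarrow> t m" for m
    using v_lim[OF V_fin[OF l_yy]] by (auto simp: U_def t_def split: nat.split)
  have u_lim: "(\<lambda>n. w n * measure (N n) (U m \<inter> {x. x \<le> c})) \<longlonglongrightarrow> u m c"
    if lc: "\<And>i. l $ i < ereal (c $ i)" for m c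
  proof (cases m)
    case (Suc k)
    have "measure (N n) (U m \<inter> {x. x \<le> c}) = measure (N n) {x. \<not> x \<le> mc k c} - measure (N n) {x. \<not> x \<le> c}" for n
    proof -
      have *: "U m \<inter> {x. x \<le> c} = {x. \<not> x \<le> mc k c} - {x. \<not> x \<le> c}"
        by (auto simp: U_def Suc le_mc)
      show ?thesis
        unfolding * by (intro N.finite_measure_Diff compl_sets) (auto simp: le_mc)
    qed
    then show ?thesis
      using tendsto_diff[OF v_lim[OF V_fin[OF l_mc[OF lc]]] v_lim[OF V_fin[OF lc]], of k]
      by (simp add: right_diff_distrib u_def Suc)
  qed (simp add: U_def u_def)
  have u_cont: "(\<lambda>n. u m (right_shift n c)) \<longlonglongrightarrow> u m c" if lc: "\<And>i. l $ i < ereal (c $ i)" for m c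
  proof (cases m)
    case (Suc k)
    have lc': "l \<le> ereal_vec c" using lc by (auto simp: less_eq_vec_def less_imp_le)
    \<comment> \<open>Shifting before taking the meet moves it by at most the shift, so the value is
      squeezed, by antitony of \<open>v\<close>, between its values at the shifted meet and at the
      meet itself.\<close>
    have "(\<lambda>n. v (mc k (right_shift n c))) \<longlonglongrightarrow> v (mc k c)"
    proof (rule tendsto_sandwich[OF _ _ v_cont[OF l_mc[OF lc]] tendsto_const])
      show "\<forall>\<^sub>F n in sequentially. v (right_shift n (mc k c)) \<le> v (mc k (right_shift n c))"
        by (intro always_eventually allI v_anti l_mc l_shift lc')
           (auto simp: less_eq_vec_def mc_def min_def intro: add_increasing2)
      show "\<forall>\<^sub>F n in sequentially. v (mc k (right_shift n c)) \<le> v (mc k c)"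
        by (intro always_eventually allI v_anti l_mc lc) (auto simp: less_eq_vec_def mc_def min_le_iff_disj)
    qed
    then show ?thesis using v_cont[OF lc] by (auto simp: u_def Suc intro: tendsto_diff)
  qed (simp add: u_def)
  define D where "D m = U (Suc m) - U m" for m
  define T where "T m = t (Suc m) - t m" for m
  define a where "a m c = u (Suc m) c - u m c" for m c
  have T_lim: "(\<lambda>n. w n * measure (N n) (D m)) \<longlonglongrightarrow> T m" for m
    using tendsto_diff[OF t_lim[of "Suc m"] t_lim[of m]]
    by (simp add: D_def T_def N.finite_measure_Diff U_sets U_mono right_diff_distrib)
  have a_lim: "(\<lambda>n. w n * measure (N n) (D m \<inter> {x. x \<le> c})) \<longlonglongrightarrow> a m c"
    if lc: "\<And>i. l $ i < ereal (c $ i)" for m c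
  proof -
    have "measure (N n) (D m \<inter> {x. x \<le> c}) = measure (N n) (U (Suc m) \<inter> {x. x \<le> c}) - measure (N n) (U m \<inter> {x. x \<le> c})" for n
    proof -
      have *: "D m \<inter> {x. x \<le> c} = (U (Suc m) \<inter> {x. x \<le> c}) - (U m \<inter> {x. x \<le> c})" by (auto simp: D_def)
      show ?thesis unfolding * using U_mono[of m]
        by (intro N.finite_measure_Diff sets.Int U_sets) (auto simp: sets_N)
    qed
    then show ?thesis
      using tendsto_diff[OF u_lim[OF lc, of "Suc m"] u_lim[OF lc, of m]]
      by (simp add: a_def right_diff_distrib)
  qed
  have T_nonneg: "0 \<le> T m" for m
    by (rule LIMSEQ_le_const[OF T_lim]) (auto intro!: exI mult_nonneg_nonneg w)
  have D_sets: "D m \<in> sets borel" for m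
    using U_sets sets_N by (auto simp: D_def)
  have "\<exists>\<kappa> :: (ereal^'d) measure. prob_space \<kappa> \<and> sets \<kappa> = sets borel \<and> (AE x in \<kappa>. l \<le> x) \<and>
    (\<forall>c. (\<forall>i. l $ i < ereal (c $ i)) \<longrightarrow> T m * measure \<kappa> {x. x \<le> ereal_vec c} = a m c)" for m
  proof (cases "T m = 0")
    \<comment> \<open>A shell of zero limiting mass gets weight 0, so any probability measure above
      \<open>l\<close> will do; the point mass at \<open>l\<close> is taken.\<close>
    case True
    have "a m c = 0" if lc: "\<And>i. l $ i < ereal (c $ i)" for c
    proof (rule antisym)
      show "0 \<le> a m c"
        by (rule LIMSEQ_le_const[OF a_lim[OF lc]]) (auto intro!: exI mult_nonneg_nonneg w)
      have "measure (N n) (D m \<inter> {x. x \<le> c}) \<le> measure (N n) (D m)" for n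
        using D_sets sets_N by (intro N.finite_measure_mono) auto
      then have "a m c \<le> T m"
        by (intro LIMSEQ_le[OF a_lim[OF lc] T_lim]) (auto intro!: exI mult_left_mono w)
      then show "a m c \<le> 0" by (simp add: True)
    qed
    moreover have "AE x in return borel l. l \<le> x"
      by (subst AE_return) (auto simp: pred_def)
    ultimately show ?thesis
      using True by (intro exI[of _ "return borel l"]) (auto simp: prob_space_return)
  next
    case False
    show ?thesis
    proof (rule limit_measure_ereal_vec[OF prob sets_N w D_sets T_lim _ a_lim, of m l])
      show "0 < T m" using False T_nonneg[of m] by simp
      show "(\<lambda>n. a m (right_shift n c)) \<longlonglongrightarrow> a m c" if "\<And>i. l $ i < ereal (c $ i)" for c
        unfolding a_def using that by (intro tendsto_diff u_cont)
    qed auto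
  qed
  then obtain \<kappa> :: "nat \<Rightarrow> (ereal^'d) measure" where \<kappa>: "\<And>m. prob_space (\<kappa> m)"
    "\<And>m. sets (\<kappa> m) = sets borel" "\<And>m. AE x in \<kappa> m. l \<le> x"
    "\<And>m c. (\<And>i. l $ i < ereal (c $ i)) \<Longrightarrow> T m * measure (\<kappa> m) {x. x \<le> ereal_vec c} = a m c"
    by metis
  interpret K: prob_space "\<kappa> m" for m by (rule \<kappa>(1))
  have sp_\<kappa>: "space (\<kappa> m) = UNIV" for m using sets_eq_imp_space_eq[OF \<kappa>(2)[of m]] by simp
  \<comment> \<open>Binding the weights \<open>T m\<close> on the naturals with the kernels
    \<open>\<kappa> m\<close> forms the measure with value the sum over \<open>m\<close> of
    \<open>T m\<close> times \<open>\<kappa> m\<close>.\<close>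
  define C where "C = density (count_space UNIV) (\<lambda>m. ennreal (T m))"
  define \<mu>0 where "\<mu>0 = C \<bind> \<kappa>"
  have kern: "\<kappa> \<in> measurable C (subprob_algebra borel)"
    using \<kappa>(2) by (auto simp: C_def measurable_def space_subprob_algebra prob_space_imp_subprob_space \<kappa>(1))
  have \<mu>0_sets: "sets \<mu>0 = sets borel"
    unfolding \<mu>0_def by (rule sets_bind) (auto simp: \<kappa>(2) C_def)
  have \<mu>0: "emeasure \<mu>0 A = (\<Sum>m. ennreal (T m) * emeasure (\<kappa> m) A)" if "A \<in> sets borel" for A
    unfolding \<mu>0_def using that kern
    by (subst emeasure_bind[where N=borel])
       (auto simp: C_def nn_integral_density nn_integral_count_space_nat)
  have gt: "emeasure \<mu>0 {x. \<not> x \<le> ereal_vec y} = V y" if ly: "\<And>i. l $ i < ereal (y $ i)" for y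
  proof -
    have E: "{x. \<not> x \<le> ereal_vec y} = space (\<kappa> m) - {x. x \<le> ereal_vec y}" for m by (auto simp: sp_\<kappa>)
    have "emeasure (\<kappa> m) {x. \<not> x \<le> ereal_vec y} = ennreal (1 - measure (\<kappa> m) {x. x \<le> ereal_vec y})" for m
      unfolding E[of m] by (simp add: K.emeasure_eq_measure K.prob_compl \<kappa>(2))
    then have "ennreal (T m) * emeasure (\<kappa> m) {x. \<not> x \<le> ereal_vec y} = ennreal (T m - a m y)" for m
      using \<kappa>(4)[OF ly, of m] T_nonneg[of m]
      by (simp add: ennreal_mult[symmetric] right_diff_distrib)
    then have "emeasure \<mu>0 {x. \<not> x \<le> ereal_vec y} = (\<Sum>m. ennreal (T m - a m y))"
      by (simp add: \<mu>0)
    also have "\<dots> = ennreal (v y)"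
    proof (rule suminf_ennreal_eq)
      show "0 \<le> T m - a m y" for m
        using \<kappa>(4)[OF ly, of m] mult_left_mono[OF K.prob_le_1 T_nonneg, of m m "{x. x \<le> ereal_vec y}"] by simp
      \<comment> \<open>The limiting mass of the part of \<open>U m\<close> not below
        \<open>y\<close>. Once the orthant at \<open>yy\<close> lies inside the orthant at
        \<open>y\<close>, this part is the full complement and \<open>s\<close> is constantly
        \<open>v y\<close>, so the telescoping series has that sum.\<close>
      define s where "s m = t m - u m y" for m
      obtain M where M: "\<And>m. M \<le> m \<Longrightarrow> yy m \<le> y" using yy_below[OF ly] by blast
      have "s m = v y" if m: "Suc M \<le> m" for m
      proof -
        obtain k where k: "m = Suc k" "M \<le> k" using m by (cases m) auto
        have "mc k y = yy k" using M[OF k(2)] by (simp add: mc_def vec_eq_iff less_eq_vec_def min_absorb1)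
        then show ?thesis by (simp add: s_def t_def u_def k)
      qed
      then have "s \<longlonglongrightarrow> v y"
        by (intro tendsto_eventually) (auto simp: eventually_sequentially)
      then have "(\<lambda>m. s (Suc m) - s m) sums (v y - s 0)" by (rule telescope_sums)
      then show "(\<lambda>m. T m - a m y) sums v y"
        by (simp add: s_def T_def a_def t_def[of 0] u_def[of 0] algebra_simps)
    qed
    also have "\<dots> = V y" using V_fin[OF ly] by (simp add: v_def)
    finally show ?thesis .
  qed
  \<comment> \<open>On the boundary of the rectangle above \<open>l\<close> the value may be
    infinite. It is reached by continuity from below along the complements at the shifted points,
    which lie in the interior.\<close>
  have ge: "emeasure \<mu>0 {x. \<not> x \<le> ereal_vec y} = V y" if ly: "l \<le> ereal_vec y" for y
  proof -
    have sets_c: "{x. \<not> x \<le> ereal_vec c} \<in> sets \<mu>0" for c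
      by (simp add: \<mu>0_sets)
    have "(\<lambda>n. emeasure \<mu>0 {x. \<not> x \<le> ereal_vec (right_shift n y)}) \<longlonglongrightarrow> emeasure \<mu>0 (\<Union>n. {x. \<not> x \<le> ereal_vec (right_shift n y)})"
      using sets_c
      by (intro Lim_emeasure_incseq)
         (auto simp: incseq_def dest: order_trans[OF _ ereal_vec_mono[OF decseq_right_shift]])
    moreover have "(\<Union>n. {x. \<not> x \<le> ereal_vec (right_shift n y)}) = {x. \<not> x \<le> ereal_vec y}"
      by (subst le_ereal_vec_iff_right_shift[of _ y]) auto
    moreover have "(\<lambda>n. emeasure \<mu>0 {x. \<not> x \<le> ereal_vec (right_shift n y)}) \<longlonglongrightarrow> V y"
      using cont[of y] by (simp add: gt[OF l_shift[OF ly]])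
    ultimately show ?thesis by (auto intro: LIMSEQ_unique)
  qed
  have AE_l: "AE x in \<mu>0. l \<le> x"
  proof (rule AE_I')
    have Ul: "{x. \<not> l \<le> x} \<in> sets borel" by simp
    have "emeasure (\<kappa> m) {x. \<not> l \<le> x} = 0" for m
      using \<kappa>(3)[of m] Ul \<kappa>(2) by (subst AE_iff_measurable[symmetric, of _ _ "\<lambda>x. l \<le> x"]) (auto simp: sp_\<kappa>)
    then show "{x. \<not> l \<le> x} \<in> null_sets \<mu>0"
      using Ul by (intro null_setsI) (auto simp: \<mu>0 \<mu>0_sets)
  qed auto
  define \<Omega> where "\<Omega> = {x. l \<le> x} - {l}"
  have "\<Omega> = {x. l \<le> x} - {x. x \<le> l}" by (auto simp: \<Omega>_def)
  then have \<Omega>_sets: "\<Omega> \<in> sets borel" by simp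
  \<comment> \<open>Removing \<open>l\<close> discards at most an atom there, and no set
    \<open>rect_compl l y\<close> with \<open>l \<le> ereal_vec y\<close> contains
    \<open>l\<close>.\<close>
  define \<mu> where "\<mu> = restrict_space \<mu>0 \<Omega>"
  have \<mu>_eq: "emeasure \<mu> A = emeasure \<mu>0 A" if "A \<subseteq> \<Omega>" for A
    unfolding \<mu>_def using that \<Omega>_sets \<mu>0_sets by (intro emeasure_restrict_space) auto
  have rect_\<mu>: "emeasure \<mu> (rect_compl l y) = V y" if ly: "l \<le> ereal_vec y" for y
  proof -
    have "emeasure \<mu> (rect_compl l y) = emeasure \<mu>0 (rect_compl l y)"
      using ly by (intro \<mu>_eq) (auto simp: rect_compl_def \<Omega>_def)
    also have "\<dots> = emeasure \<mu>0 {x. \<not> x \<le> ereal_vec y}"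
    proof (rule emeasure_eq_AE)
      show "AE x in \<mu>0. x \<in> rect_compl l y \<longleftrightarrow> x \<in> {x. \<not> x \<le> ereal_vec y}"
        using AE_l by eventually_elim (auto simp: rect_compl_def)
      show "{x. \<not> x \<le> ereal_vec y} \<in> sets \<mu>0" by (simp add: \<mu>0_sets)
      have r: "rect_compl l y = {x. l \<le> x} - {x. x \<le> ereal_vec y}" by (auto simp: rect_compl_def)
      show "rect_compl l y \<in> sets \<mu>0" unfolding r \<mu>0_sets by (intro sets.Diff) auto
    qed
    also have "\<dots> = V y" by (rule ge[OF ly])
    finally show ?thesis .
  qed
  show ?thesis
  proof (rule that[of l \<mu>])
    show "sets \<mu> = sets (restrict_space borel ({x. l \<le> x} - {l}))"
      unfolding \<mu>_def \<Omega>_def[symmetric] by (rule sets_restrict_space_cong[OF \<mu>0_sets])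
    fix K assume K: "compact K" "K \<subseteq> {x. l \<le> x} - {l}"
    \<comment> \<open>These open sets increase and cover everything above \<open>l\<close> except
      \<open>l\<close> itself, so a compact set lies in one of them, and there the mass is
      \<open>V (yy M)\<close>, finite because \<open>yy M\<close> is strictly above
      \<open>l\<close>.\<close>
    let ?W = "\<lambda>m. {x. \<not> x \<le> ereal_vec (yy m)}"
    have openW: "open (?W m)" for m
      using open_Compl[OF closed_vec_atMost[of "ereal_vec (yy m)"]] by (simp add: Compl_eq)
    have cover: "K \<subseteq> (\<Union>m\<in>UNIV. ?W m)"
    proof
      fix x assume "x \<in> K"
      then have "l \<le> x" "x \<noteq> l" using K(2) by auto
      then obtain i where "l $ i < x $ i"
        by (metis less_eq_vec_def order_le_less vec_eq_iff)
      then obtain m where "ereal (yy m $ i) < x $ i" using yy_conv by blast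
      then have "\<not> x \<le> ereal_vec (yy m)" by (auto simp: less_eq_vec_def not_le)
      then show "x \<in> (\<Union>m\<in>UNIV. ?W m)" by blast
    qed
    obtain S where S: "finite S" "K \<subseteq> (\<Union>m\<in>S. ?W m)"
      by (rule compactE_image[OF K(1) openW cover])
    define M where "M = Max (insert 0 S)"
    have "K \<subseteq> ?W M"
    proof
      fix x assume "x \<in> K"
      then obtain m where m: "m \<in> S" "\<not> x \<le> ereal_vec (yy m)" using S by blast
      have "m \<le> M" using S(1) m(1) by (auto simp: M_def)
      then show "x \<in> ?W M"
        using m(2) order_trans[OF _ ereal_vec_mono[OF yy_mono[OF \<open>m \<le> M\<close>]], of x] by blast
    qed
    have "K \<subseteq> rect_compl l (yy M)" using K(2) \<open>K \<subseteq> ?W M\<close> by (auto simp: rect_compl_def)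
    have lM: "l \<le> ereal_vec (yy M)" using l_yy by (auto simp: less_eq_vec_def less_imp_le)
    have "emeasure \<mu> K \<le> emeasure \<mu> (rect_compl l (yy M))"
    proof (rule emeasure_mono[OF \<open>K \<subseteq> rect_compl l (yy M)\<close>])
      have r: "rect_compl l (yy M) = {x. l \<le> x} - {x. x \<le> ereal_vec (yy M)}" by (auto simp: rect_compl_def)
      have "rect_compl l (yy M) \<in> sets borel" unfolding r by (intro sets.Diff) auto
      moreover have "rect_compl l (yy M) \<subseteq> \<Omega>" using lM by (auto simp: rect_compl_def \<Omega>_def)
      ultimately show "rect_compl l (yy M) \<in> sets \<mu>"
        unfolding \<mu>_def using \<Omega>_sets by (subst sets_restrict_space_iff) (auto simp: \<mu>0_sets)
    qed
    also have "\<dots> < \<infinity>" using rect_\<mu>[OF lM] V_fin[OF l_yy] by simp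
    finally show "emeasure \<mu> K < \<infinity>" .
  qed (use l_fin V_inf rect_\<mu> in auto)
qed

subsection \<open>The Laplace transform as a map on \<open>[0, \<infinity>]\<close>\<close>

lemma exp_neg_ennreal: "0 \<le> x \<Longrightarrow> exp_neg (ennreal x) = exp (- x)"
  by (simp add: exp_neg_def)

lemma exp_neg_top [simp]: "exp_neg top = 0"
  by (simp add: exp_neg_def)

lemma exp_neg_nonneg [simp]: "0 \<le> exp_neg v"
  by (simp add: exp_neg_def)

lemma exp_neg_le_1 [simp]: "exp_neg v \<le> 1"
  by (simp add: exp_neg_def)

lemma borel_measurable_exp_neg [measurable]: "exp_neg \<in> borel_measurable borel"
  unfolding exp_neg_def[abs_def] by measurable

lemma exp_neg_strict_antimono:
  assumes "u < v" shows "exp_neg v < exp_neg u"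
proof (cases v)
  case (real b)
  then obtain a where "u = ennreal a" "0 \<le> a" using assms by (cases u) auto
  then show ?thesis using assms real by (simp add: exp_neg_ennreal ennreal_less_iff)
next
  case top
  then show ?thesis using assms by (auto simp: exp_neg_def)
qed

lemma tendsto_exp_neg:
  assumes "(f \<longlongrightarrow> v) F" shows "((\<lambda>x. exp_neg (f x)) \<longlongrightarrow> exp_neg v) F"
proof (rule order_tendstoI)
  fix a assume a: "a < exp_neg v"
  show "eventually (\<lambda>x. a < exp_neg (f x)) F"
  proof (cases "a < 0")
    case True
    then show ?thesis by (auto intro!: always_eventually less_le_trans[OF True])
  next
    case False
    then obtain b where b: "v = ennreal b" "0 \<le> b" using a by (cases v) auto
    \<comment> \<open>The midpoint is positive even when \<open>a = 0\<close>, so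
      \<open>- ln c\<close> is a real threshold strictly above \<open>b\<close>.\<close>
    define c where "c = (a + exp (- b)) / 2"
    have c: "a < c" "c < exp (- b)" using a b by (simp_all add: c_def exp_neg_ennreal)
    have c0: "0 < c" using c False by simp
    have "b < - ln c" using c c0 by (metis exp_less_cancel_iff exp_ln less_minus_iff)
    then have "v < ennreal (- ln c)" using b by (simp add: ennreal_less_iff)
    then have "eventually (\<lambda>x. f x < ennreal (- ln c)) F" using assms by (rule order_tendstoD(2)[rotated])
    then show ?thesis
    proof eventually_elim
      case (elim x)
      have "a < c" by fact
      also have "c = exp_neg (ennreal (- ln c))"
      proof -
        have "0 \<le> - ln c" using \<open>b < - ln c\<close> b(2) by linarith
        then show ?thesis using c0 by (simp only: exp_neg_ennreal) simp
      qed
      also have "\<dots> < exp_neg (f x)" by (rule exp_neg_strict_antimono[OF elim])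
      finally show ?case .
    qed
  qed
next
  fix a assume a: "exp_neg v < a"
  show "eventually (\<lambda>x. exp_neg (f x) < a) F"
  proof (cases "1 < a")
    case True
    then show ?thesis by (auto intro!: always_eventually le_less_trans[OF _ True])
  next
    case False
    have a0: "0 < a" using a exp_neg_nonneg[of v] by linarith
    have "ennreal (- ln a) < v"
    proof (cases v)
      case (real b)
      then have "exp (- b) < a" using a by (simp add: exp_neg_ennreal)
      then have "- ln a < b" using a0 by (metis exp_less_cancel_iff exp_ln minus_less_iff)
      then show ?thesis using real False a0 by (simp add: ennreal_less_iff)
    qed simp
    then have "eventually (\<lambda>x. ennreal (- ln a) < f x) F" using assms by (rule order_tendstoD(1)[rotated])
    then show ?thesis
    proof eventually_elim
      case (elim x)
      have "exp_neg (f x) < exp_neg (ennreal (- ln a))" by (rule exp_neg_strict_antimono[OF elim])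
      also have "\<dots> = a" using a0 False by (simp add: exp_neg_ennreal)
      finally show ?case .
    qed
  qed
qed

section \<open>The Laplace transform of a positive random variable\<close>

locale positive_random_variable = prob_space M for M :: "'a measure" +
  fixes Z :: "'a \<Rightarrow> real"
  assumes Z_measurable [measurable]: "Z \<in> borel_measurable M" and Z_pos: "AE \<omega> in M. Z \<omega> > 0"
begin

text \<open>Since \<open>Z\<close> is almost surely positive, \<open>\<infinity> * Z\<close> is
  almost surely \<open>\<infinity>\<close> and the integrand vanishes there. The convention at
  \<open>\<infinity>\<close> thus becomes part of one formula, and monotonicity and dominated
  convergence extend to the whole of \<open>[0, \<infinity>]\<close>.\<close>

lemma laplace_transform_eq: "laplace_transform M Z v = (\<integral>\<omega>. exp_neg (v * ennreal (Z \<omega>)) \<partial>M)"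
proof (cases v)
  case (real r)
  show ?thesis
    unfolding laplace_transform_def using real
  proof (simp, intro integral_cong_AE)
    show "AE \<omega> in M. exp (- (r * Z \<omega>)) = exp_neg (ennreal r * ennreal (Z \<omega>))"
      using Z_pos
    proof eventually_elim
      case (elim \<omega>)
      then show ?case using real by (simp add: ennreal_mult[symmetric] exp_neg_ennreal)
    qed
  qed measurable
next
  case top
  have "(\<integral>\<omega>. exp_neg (\<infinity> * ennreal (Z \<omega>)) \<partial>M) = (\<integral>\<omega>. 0 \<partial>M)"
  proof (intro integral_cong_AE)
    show "AE \<omega> in M. exp_neg (\<infinity> * ennreal (Z \<omega>)) = 0"
      using Z_pos by eventually_elim (auto simp: ennreal_top_mult exp_neg_def)
  qed measurable
  then show ?thesis using top by (simp add: laplace_transform_def)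
qed

lemma integrable_exp_neg: "integrable M (\<lambda>\<omega>. exp_neg (v * ennreal (Z \<omega>)))"
  by (rule integrable_const_bound[of _ 1]) (auto intro!: always_eventually)

lemma laplace_transform_strict_antimono:
  assumes "u < v" shows "laplace_transform M Z v < laplace_transform M Z u"
  unfolding laplace_transform_eq
proof (rule integral_less_AE_space)
  show "AE \<omega> in M. exp_neg (v * ennreal (Z \<omega>)) < exp_neg (u * ennreal (Z \<omega>))"
    using Z_pos
  proof eventually_elim
    case (elim \<omega>)
    then have "u * ennreal (Z \<omega>) < v * ennreal (Z \<omega>)"
      using assms by (intro ennreal_mult_strict_right_mono) auto
    then show ?case by (rule exp_neg_strict_antimono)
  qed
qed (auto simp: integrable_exp_neg emeasure_space_1)

lemma laplace_transform_antimono: "u \<le> v \<Longrightarrow> laplace_transform M Z v \<le> laplace_transform M Z u"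
  using laplace_transform_strict_antimono[of u v] by (cases "u = v") (auto simp: less_le)

lemma laplace_transform_less_iff: "laplace_transform M Z u < laplace_transform M Z v \<longleftrightarrow> v < u"
  using laplace_transform_strict_antimono[of v u] laplace_transform_antimono[of u v] by force

lemma laplace_transform_0 [simp]: "laplace_transform M Z 0 = 1"
  by (simp add: laplace_transform_def prob_space)

lemma laplace_transform_top [simp]: "laplace_transform M Z top = 0"
  by (simp add: laplace_transform_def)

lemma laplace_transform_nonneg: "0 \<le> laplace_transform M Z v"
  unfolding laplace_transform_eq by (intro integral_nonneg_AE) auto

lemma tendsto_laplace_transform:
  fixes v :: "nat \<Rightarrow> ennreal"
  assumes "v \<longlonglongrightarrow> u"
  shows "(\<lambda>n. laplace_transform M Z (v n)) \<longlonglongrightarrow> laplace_transform M Z u"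
  unfolding laplace_transform_eq
proof (rule integral_dominated_convergence[where w="\<lambda>_. 1"])
  show "AE \<omega> in M. (\<lambda>n. exp_neg (v n * ennreal (Z \<omega>))) \<longlonglongrightarrow> exp_neg (u * ennreal (Z \<omega>))"
    using Z_pos
  proof eventually_elim
    case (elim \<omega>)
    have "(\<lambda>n. ennreal (Z \<omega>) * v n) \<longlonglongrightarrow> ennreal (Z \<omega>) * u"
      by (intro ennreal_tendsto_cmult assms) simp
    then show ?case by (intro tendsto_exp_neg) (simp add: mult.commute)
  qed
qed (auto intro!: always_eventually)

text \<open>Strict antitony turns the open rays around \<open>u\<close> into open rays around the
  transformed value, so convergence can be pulled back in the order topology.\<close>

lemma tendsto_laplace_transform_cancel:
  fixes v :: "nat \<Rightarrow> ennreal"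
  assumes "(\<lambda>n. laplace_transform M Z (v n)) \<longlonglongrightarrow> laplace_transform M Z u"
  shows "v \<longlonglongrightarrow> u"
proof (rule order_tendstoI)
  fix a assume "a < u"
  then show "eventually (\<lambda>n. a < v n) sequentially"
    using order_tendstoD(2)[OF assms, of "laplace_transform M Z a"] by (simp add: laplace_transform_less_iff)
next
  fix a assume "u < a"
  then show "eventually (\<lambda>n. v n < a) sequentially"
    using order_tendstoD(1)[OF assms, of "laplace_transform M Z a"] by (simp add: laplace_transform_less_iff)
qed

text \<open>The value 0 is attained at \<open>top\<close>. For positive \<open>p\<close> the
  transform drops below \<open>p\<close> at some natural number, and the intermediate value theorem
  applies on the interval up to it.\<close>

lemma laplace_transform_surj:
  assumes "0 \<le> p" "p \<le> 1" obtains v where "laplace_transform M Z v = p"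
proof (cases "p = 0")
  case True
  show ?thesis using that[of top] True by simp
next
  case False
  have "(\<lambda>n. laplace_transform M Z (of_nat n)) \<longlonglongrightarrow> laplace_transform M Z top"
    by (intro tendsto_laplace_transform) (simp add: of_nat_tendsto_top_ennreal)
  then have "eventually (\<lambda>n. laplace_transform M Z (of_nat n) < p) sequentially"
    using False assms by (intro order_tendstoD(2)) auto
  then obtain n :: nat where n: "laplace_transform M Z (ennreal (real n)) < p"
    by (auto simp: eventually_sequentially ennreal_of_nat_eq_real_of_nat)
  have "continuous_on {0..real n} (\<lambda>x. laplace_transform M Z (ennreal x))"
    unfolding continuous_on_sequentially comp_def
    by (auto intro!: tendsto_laplace_transform tendsto_ennrealI)
  then obtain x where "laplace_transform M Z (ennreal x) = p"
    using IVT2'[of "\<lambda>x. laplace_transform M Z (ennreal x)" "real n" p 0] n assms by auto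
  then show ?thesis by (rule that)
qed

text \<open>The generating function of \<open>j + k N\<close>, where \<open>N\<close> is Poisson distributed with random
  parameter \<open>Z / t\<close>.\<close>

lemma prob_gen_fun_laplace_transform:
  assumes t: "0 < t"
  shows "prob_gen_fun (\<lambda>s. s ^ j * laplace_transform M Z (ennreal ((1 - s ^ k) / t)))"
proof -
  \<comment> \<open>The absolute value makes the Poisson parameter nonnegative everywhere, not just
    almost surely; \<open>f m\<close> is then the Poisson weight of \<open>m\<close> given the
    outcome.\<close>
  define r where "r \<omega> = \<bar>Z \<omega>\<bar> / t" for \<omega>
  have r_nonneg: "0 \<le> r \<omega>" for \<omega> using t by (simp add: r_def)
  have r_meas [measurable]: "r \<in> borel_measurable M" unfolding r_def by measurable
  define f where "f m \<omega> = exp (- r \<omega>) * (r \<omega> ^ m / fact m)" for m :: nat and \<omega>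
  have f_nonneg: "0 \<le> f m \<omega>" for m \<omega> using r_nonneg by (simp add: f_def)
  have f_meas [measurable]: "f m \<in> borel_measurable M" for m unfolding f_def by measurable
  define p where "p m = enn2real (\<integral>\<^sup>+ \<omega>. ennreal (f m \<omega>) \<partial>M)" for m
  have sums: "(\<lambda>m. f m \<omega> * s ^ (i + l * m)) sums (s ^ i * exp (- (r \<omega> * (1 - s ^ l))))" for s \<omega> i l
  proof -
    have "(\<lambda>m. (r \<omega> * s ^ l) ^ m /\<^sub>R fact m) sums exp (r \<omega> * s ^ l)" by (rule exp_converges)
    then have "(\<lambda>m. s ^ i * exp (- r \<omega>) * ((r \<omega> * s ^ l) ^ m /\<^sub>R fact m)) sums (s ^ i * exp (- r \<omega>) * exp (r \<omega> * s ^ l))"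
      by (rule sums_mult)
    moreover have "s ^ i * exp (- r \<omega>) * ((r \<omega> * s ^ l) ^ m /\<^sub>R fact m) = f m \<omega> * s ^ (i + l * m)" for m
      by (simp add: f_def power_add power_mult power_mult_distrib field_simps)
    moreover have "s ^ i * exp (- r \<omega>) * exp (r \<omega> * s ^ l) = s ^ i * exp (- (r \<omega> * (1 - s ^ l)))"
      by (simp add: mult.assoc exp_add[symmetric] algebra_simps)
    ultimately show ?thesis by simp
  qed
  \<comment> \<open>Exponents \<open>i\<close> and \<open>l\<close> are kept general:
    \<open>s = 1\<close> with both exponents 0 gives the total mass 1, and \<open>i = j\<close>,
    \<open>l = k\<close> gives the generating function.\<close>
  have total: "(\<Sum>m. (\<integral>\<^sup>+ \<omega>. ennreal (f m \<omega>) \<partial>M) * ennreal (s ^ (i + l * m)))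
      = (\<integral>\<^sup>+ \<omega>. ennreal (s ^ i * exp (- (r \<omega> * (1 - s ^ l)))) \<partial>M)" if s: "0 \<le> s" for s i l
  proof -
    have "(\<integral>\<^sup>+ \<omega>. ennreal (f m \<omega>) \<partial>M) * ennreal (s ^ (i + l * m)) = (\<integral>\<^sup>+ \<omega>. ennreal (f m \<omega> * s ^ (i + l * m)) \<partial>M)" for m
      using s by (simp add: ennreal_mult f_nonneg nn_integral_multc)
    then have "(\<Sum>m. (\<integral>\<^sup>+ \<omega>. ennreal (f m \<omega>) \<partial>M) * ennreal (s ^ (i + l * m)))
        = (\<integral>\<^sup>+ \<omega>. (\<Sum>m. ennreal (f m \<omega> * s ^ (i + l * m))) \<partial>M)"
      by (simp add: nn_integral_suminf)
    also have "\<dots> = (\<integral>\<^sup>+ \<omega>. ennreal (s ^ i * exp (- (r \<omega> * (1 - s ^ l)))) \<partial>M)"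
      using s by (intro nn_integral_cong suminf_ennreal_eq sums) (simp add: f_nonneg)
    finally show ?thesis .
  qed
  have one: "(\<Sum>m. \<integral>\<^sup>+ \<omega>. ennreal (f m \<omega>) \<partial>M) = 1"
    using total[of 1 0 0] by (simp add: emeasure_space_1)
  have "(\<integral>\<^sup>+ \<omega>. ennreal (f m \<omega>) \<partial>M) \<le> 1" for m
    unfolding one[symmetric] using sum_le_suminf[of "\<lambda>m. \<integral>\<^sup>+ \<omega>. ennreal (f m \<omega>) \<partial>M" "{m}"] by simp
  then have p: "ennreal (p m) = (\<integral>\<^sup>+ \<omega>. ennreal (f m \<omega>) \<partial>M)" for m
    unfolding p_def by (metis ennreal_enn2real_if ennreal_one_neq_top infinity_ennreal_def top.extremum_unique)
  have p_nonneg: "0 \<le> p m" for m by (simp add: p_def)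
  have p_total: "(\<integral>\<^sup>+ m. ennreal (p m) \<partial>count_space UNIV) = 1"
    by (simp add: nn_integral_count_space_nat p one)
  define Q where "Q = embed_pmf p"
  have Q: "pmf Q m = p m" for m
    unfolding Q_def by (rule pmf_embed_pmf[OF p_nonneg p_total])
  show ?thesis
    unfolding prob_gen_fun_def
  proof (intro exI[of _ "map_pmf (\<lambda>m. j + k * m) Q"] ballI)
    fix s :: real assume "s \<in> {0..1}"
    then have s: "0 \<le> s" "s \<le> 1" by auto
    have x: "0 \<le> (1 - s ^ k) / t" using s t by (simp add: power_le_one)
    have "measure_pmf.expectation (map_pmf (\<lambda>m. j + k * m) Q) (\<lambda>n. s ^ n) = measure_pmf.expectation Q (\<lambda>m. s ^ (j + k * m))"
      by simp
    also have "\<dots> = enn2real (\<integral>\<^sup>+ m. ennreal (s ^ (j + k * m)) \<partial>measure_pmf Q)"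
      using s by (intro integral_eq_nn_integral) auto
    also have "(\<integral>\<^sup>+ m. ennreal (s ^ (j + k * m)) \<partial>measure_pmf Q) = (\<Sum>m. ennreal (p m) * ennreal (s ^ (j + k * m)))"
      by (simp add: nn_integral_measure_pmf nn_integral_count_space_nat Q)
    also have "\<dots> = (\<integral>\<^sup>+ \<omega>. ennreal (s ^ j * exp (- (r \<omega> * (1 - s ^ k)))) \<partial>M)"
      unfolding p by (rule total[OF s(1)])
    also have "enn2real \<dots> = (\<integral>\<omega>. s ^ j * exp (- (r \<omega> * (1 - s ^ k))) \<partial>M)"
      using s by (intro integral_eq_nn_integral[symmetric]) auto
    also have "\<dots> = s ^ j * (\<integral>\<omega>. exp (- (r \<omega> * (1 - s ^ k))) \<partial>M)" by simp
    also have "(\<integral>\<omega>. exp (- (r \<omega> * (1 - s ^ k))) \<partial>M) = laplace_transform M Z (ennreal ((1 - s ^ k) / t))"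
      unfolding laplace_transform_def using x
    proof (simp, intro integral_cong_AE)
      show "AE \<omega> in M. exp (- (r \<omega> * (1 - s ^ k))) = exp (- ((1 - s ^ k) * Z \<omega> / t))"
        using Z_pos by eventually_elim (simp add: r_def mult.commute)
    qed measurable
    finally show "s ^ j * laplace_transform M Z (ennreal ((1 - s ^ k) / t))
      = measure_pmf.expectation (map_pmf (\<lambda>m. j + k * m) Q) (\<lambda>n. s ^ n)" by simp
  qed
qed

end

subsection \<open>Rescaled defects of distribution functions\<close>

lemma distribution_fun_bounds:
  assumes "distribution_fun F" shows "0 \<le> F y" "F y \<le> 1"
  using assms unfolding distribution_fun_def by (auto simp: prob_space.prob_le_1)

lemma distribution_fun_right_continuous:
  assumes "distribution_fun F" shows "(\<lambda>n. F (right_shift n y)) \<longlonglongrightarrow> F y"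
proof -
  obtain M where M: "prob_space M" "sets M = sets borel" "\<And>y. F y = measure M {x. x \<le> y}"
    using assms unfolding distribution_fun_def by metis
  interpret prob_space M by (rule M(1))
  have "(\<lambda>n. measure M {x. x \<le> right_shift n y}) \<longlonglongrightarrow> measure M (\<Inter>n. {x. x \<le> right_shift n y})"
    by (intro finite_Lim_measure_decseq)
       (auto simp: M(2) decseq_def dest: order_trans[OF _ decseq_right_shift])
  moreover have "x \<le> y \<longleftrightarrow> (\<forall>n. x \<le> right_shift n y)" for x
    using le_ereal_vec_iff_right_shift[of "ereal_vec x" y] by (simp add: less_eq_vec_def)
  then have "(\<Inter>n. {x. x \<le> right_shift n y}) = {x. x \<le> y}" by auto
  ultimately show ?thesis by (simp add: M(3))
qed

lemma distribution_fun_at_top: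
  fixes F :: "real^'d \<Rightarrow> real"
  assumes "distribution_fun F" shows "(\<lambda>n. F (\<chi> i. real n)) \<longlonglongrightarrow> 1"
proof -
  obtain M where M: "prob_space M" "sets M = sets borel" "\<And>y. F y = measure M {x. x \<le> y}"
    using assms unfolding distribution_fun_def by metis
  interpret prob_space M by (rule M(1))
  let ?A = "\<lambda>n. {x :: real^'d. x \<le> (\<chi> i. real n)}"
  have "(\<lambda>n. measure M (?A n)) \<longlonglongrightarrow> measure M (\<Union>n. ?A n)"
    by (intro finite_Lim_measure_incseq)
       (auto simp: M(2) incseq_def less_eq_vec_def intro: order_trans)
  moreover have "(\<Union>n. ?A n) = space M"
  proof -
    have "\<exists>n. x \<le> (\<chi> i. real n)" for x :: "real^'d"
    proof -
      obtain n :: nat where "norm x \<le> real n" using real_arch_simple by blast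
      then show ?thesis
        by (intro exI[of _ n]) (auto simp: less_eq_vec_def intro: order_trans[OF order_trans[OF abs_ge_self component_le_norm_cart]])
    qed
    then show ?thesis using sets_eq_imp_space_eq[OF M(2)] by auto
  qed
  ultimately show ?thesis by (simp add: M(3) prob_space)
qed

lemma distribution_fun_at_bot:
  fixes F :: "real^'d \<Rightarrow> real"
  assumes "distribution_fun F" shows "(\<lambda>n. F (\<chi> j. if j = i then - real n else y $ j)) \<longlonglongrightarrow> 0"
proof -
  obtain M where M: "prob_space M" "sets M = sets borel" "\<And>y. F y = measure M {x. x \<le> y}"
    using assms unfolding distribution_fun_def by metis
  interpret prob_space M by (rule M(1))
  let ?A = "\<lambda>n. {x :: real^'d. x \<le> (\<chi> j. if j = i then - real n else y $ j)}"
  have mono: "(\<chi> j. if j = i then - real n else y $ j) \<le> (\<chi> j. if j = i then - real m else y $ j)"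
    if "m \<le> n" for m n using that by (simp add: less_eq_vec_def)
  have "(\<lambda>n. measure M (?A n)) \<longlonglongrightarrow> measure M (\<Inter>n. ?A n)"
    by (intro finite_Lim_measure_decseq)
       (auto simp: M(2) decseq_def dest: order_trans[OF _ mono])
  moreover have "(\<Inter>n. ?A n) = {}"
  proof -
    have "\<not> (\<forall>n. x \<le> (\<chi> j. if j = i then - real n else y $ j))" for x
    proof
      assume *: "\<forall>n. x \<le> (\<chi> j. if j = i then - real n else y $ j)"
      have "x $ i \<le> - real n" for n using spec[OF *, of n] by (auto simp: less_eq_vec_def dest: spec[of _ i])
      moreover obtain n :: nat where "- (x $ i) < real n" using reals_Archimedean2 by blast
      ultimately show False by (metis minus_less_iff not_le)
    qed
    then show ?thesis by auto
  qed
  ultimately show ?thesis by (simp add: M(3))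
qed

section \<open>From rescaled defects to exponentials and back\<close>

text \<open>This is the limit of \<open>(1 - \<theta> b) ^ (\<tau> / \<theta>)\<close> with the
  exponent rounded to an integer. Using \<open>Suc\<close> keeps the exponent positive, so that
  powers of distribution functions remain distribution functions.\<close>

lemma power_Suc_floor_tendsto_exp_neg:
  fixes h \<theta> :: "nat \<Rightarrow> real"
  assumes h: "\<And>n. 0 \<le> h n" "\<And>n. h n \<le> 1" and \<theta>: "\<And>n. 0 < \<theta> n" "\<theta> \<longlonglongrightarrow> 0" and \<tau>: "0 < \<tau>"
    and lim: "(\<lambda>n. ennreal ((1 - h n) / \<theta> n)) \<longlonglongrightarrow> v"
  shows "(\<lambda>n. h n ^ Suc (nat \<lfloor>\<tau> / \<theta> n\<rfloor>)) \<longlonglongrightarrow> exp_neg (ennreal \<tau> * v)"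
proof -
  define m where "m n = Suc (nat \<lfloor>\<tau> / \<theta> n\<rfloor>)" for n
  have q: "0 < \<tau> / \<theta> n" for n using \<theta>(1) \<tau> by simp
  have m_lower: "\<tau> / \<theta> n \<le> real (m n)" for n
    using q[of n] by (simp add: m_def) linarith
  have m_upper: "real (m n) \<le> \<tau> / \<theta> n + 1" for n
    using q[of n] by (simp add: m_def)
  have up: "h n ^ m n \<le> exp (- (real (m n) * (1 - h n)))" for n
  proof -
    have "h n \<le> exp (h n - 1)" using exp_ge_add_one_self[of "h n - 1"] by simp
    then have "h n ^ m n \<le> exp (h n - 1) ^ m n" using h by (intro power_mono)
    also have "\<dots> = exp (- (real (m n) * (1 - h n)))"
      by (simp add: exp_of_nat_mult[symmetric] algebra_simps)
    finally show ?thesis .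
  qed
  have "(\<lambda>n. h n ^ m n) \<longlonglongrightarrow> exp_neg (ennreal \<tau> * v)"
  proof (cases v)
    case (real b)
    have b: "(\<lambda>n. (1 - h n) / \<theta> n) \<longlonglongrightarrow> b"
      using tendsto_enn2real[OF lim[unfolded real(2)] real(1)] h \<theta>(1) by (simp add: less_imp_le)
    have "(\<lambda>n. (1 - h n) / \<theta> n * \<theta> n) \<longlonglongrightarrow> b * 0" by (intro tendsto_mult b \<theta>(2))
    then have h1: "(\<lambda>n. 1 - h n) \<longlonglongrightarrow> 0" using \<theta>(1) by (simp add: less_imp_neq[symmetric])
    then have hl: "h \<longlonglongrightarrow> 1" using tendsto_diff[OF tendsto_const[of 1] h1] by simp
    have mh: "(\<lambda>n. real (m n) * (1 - h n)) \<longlonglongrightarrow> \<tau> * b"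
    proof (rule tendsto_sandwich)
      show "\<forall>\<^sub>F n in sequentially. \<tau> * ((1 - h n) / \<theta> n) \<le> real (m n) * (1 - h n)"
        using mult_right_mono[OF m_lower] h(2) by (auto intro!: always_eventually)
      show "\<forall>\<^sub>F n in sequentially. real (m n) * (1 - h n) \<le> \<tau> * ((1 - h n) / \<theta> n) + (1 - h n)"
      proof (intro always_eventually allI)
        fix n
        have "real (m n) * (1 - h n) \<le> (\<tau> / \<theta> n + 1) * (1 - h n)"
          using mult_right_mono[OF m_upper[of n], of "1 - h n"] h(2)[of n] by simp
        then show "real (m n) * (1 - h n) \<le> \<tau> * ((1 - h n) / \<theta> n) + (1 - h n)"
          by (simp add: distrib_right)
      qed
      show "(\<lambda>n. \<tau> * ((1 - h n) / \<theta> n)) \<longlonglongrightarrow> \<tau> * b" by (intro tendsto_intros b)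
      have "(\<lambda>n. \<tau> * ((1 - h n) / \<theta> n) + (1 - h n)) \<longlonglongrightarrow> \<tau> * b + 0" by (intro tendsto_intros b h1)
      then show "(\<lambda>n. \<tau> * ((1 - h n) / \<theta> n) + (1 - h n)) \<longlonglongrightarrow> \<tau> * b" by simp
    qed
    have "(\<lambda>n. h n ^ m n) \<longlonglongrightarrow> exp (- (\<tau> * b))"
    \<comment> \<open>The upper bound is \<open>h \<le> exp (h - 1)\<close>; the lower bound applies
      the same inequality to \<open>1 / h\<close>. The two exponents differ by the factor
      \<open>1 / h\<close>, which tends to 1.\<close>
    proof (rule tendsto_sandwich[where f="\<lambda>n. exp (- (real (m n) * (1 - h n) / h n))"
          and h="\<lambda>n. exp (- (real (m n) * (1 - h n)))"])
      show "\<forall>\<^sub>F n in sequentially. h n ^ m n \<le> exp (- (real (m n) * (1 - h n)))"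
        using up by simp
      show "(\<lambda>n. exp (- (real (m n) * (1 - h n)))) \<longlonglongrightarrow> exp (- (\<tau> * b))"
        by (intro tendsto_intros mh)
      have "eventually (\<lambda>n. 0 < h n) sequentially" using hl by (rule order_tendstoD) simp
      then show "\<forall>\<^sub>F n in sequentially. exp (- (real (m n) * (1 - h n) / h n)) \<le> h n ^ m n"
      proof eventually_elim
        case (elim n)
        have "1 / h n \<le> exp (1 / h n - 1)" using exp_ge_add_one_self[of "1 / h n - 1"] by simp
        then have "exp (- (1 / h n - 1)) \<le> h n"
          using elim by (simp add: exp_minus divide_simps mult.commute)
        then have "exp (- (1 / h n - 1)) ^ m n \<le> h n ^ m n" by (intro power_mono) auto
        moreover have "exp (- (1 / h n - 1)) ^ m n = exp (- (real (m n) * (1 - h n) / h n))"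
          using elim by (simp add: exp_of_nat_mult[symmetric] field_simps)
        ultimately show ?case by simp
      qed
      have "(\<lambda>n. exp (- (real (m n) * (1 - h n) / h n))) \<longlonglongrightarrow> exp (- (\<tau> * b / 1))"
        by (intro tendsto_intros mh hl) simp
      then show "(\<lambda>n. exp (- (real (m n) * (1 - h n) / h n))) \<longlonglongrightarrow> exp (- (\<tau> * b))" by simp
    qed
    then show ?thesis using real \<tau> by (simp add: ennreal_mult[symmetric] exp_neg_ennreal)
  next
    case top
    have "(\<lambda>n. exp_neg (ennreal \<tau> * ennreal ((1 - h n) / \<theta> n))) \<longlonglongrightarrow> exp_neg (ennreal \<tau> * v)"
      by (intro tendsto_exp_neg ennreal_tendsto_cmult lim) simp
    then have *: "(\<lambda>n. exp_neg (ennreal \<tau> * ennreal ((1 - h n) / \<theta> n))) \<longlonglongrightarrow> 0"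
      using top \<tau> by (simp add: ennreal_mult_top)
    \<comment> \<open>Here \<open>h\<close> need not tend to 1; the upper bound \<open>up\<close>
      squeezed against 0 is enough.\<close>
    have "(\<lambda>n. h n ^ m n) \<longlonglongrightarrow> 0"
    proof (rule tendsto_sandwich[OF _ _ tendsto_const *])
      show "\<forall>\<^sub>F n in sequentially. 0 \<le> h n ^ m n" using h by simp
      have "h n ^ m n \<le> exp_neg (ennreal \<tau> * ennreal ((1 - h n) / \<theta> n))" for n
      proof -
        have "\<tau> * ((1 - h n) / \<theta> n) \<le> real (m n) * (1 - h n)"
          using mult_right_mono[OF m_lower[of n], of "1 - h n"] h(2)[of n] by simp
        then have "exp (- (real (m n) * (1 - h n))) \<le> exp (- (\<tau> * ((1 - h n) / \<theta> n)))" by simp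
        also have "\<dots> = exp_neg (ennreal \<tau> * ennreal ((1 - h n) / \<theta> n))"
        proof -
          have "0 \<le> (1 - h n) / \<theta> n" using h(2)[of n] \<theta>(1)[of n] by simp
          then show ?thesis using \<tau> by (simp add: ennreal_mult[symmetric] exp_neg_ennreal del: times_divide_eq_right)
        qed
        finally show ?thesis using up[of n] by linarith
      qed
      then show "\<forall>\<^sub>F n in sequentially. h n ^ m n \<le> exp_neg (ennreal \<tau> * ennreal ((1 - h n) / \<theta> n))" by simp
    qed
    then show ?thesis using top \<tau> by (simp add: ennreal_mult_top)
  qed
  then show ?thesis by (simp add: m_def)
qed

text \<open>The transform is inverted at \<open>p\<close> to find the only possible limit
  \<open>u\<close> of \<open>(1 - h ^ k) / \<theta>\<close>; the power \<open>h ^ j\<close> does not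
  disturb it. Since \<open>1 - h ^ k\<close> is \<open>1 - h\<close> times a geometric sum tending
  to \<open>k\<close> when \<open>u\<close> is finite, the defects themselves tend to
  \<open>u\<close> divided by \<open>k\<close>.\<close>

lemma (in positive_random_variable) limit_of_rescaled_defects:
  fixes h \<theta> :: "nat \<Rightarrow> real"
  assumes h: "\<And>n. 0 \<le> h n" "\<And>n. h n \<le> 1" and \<theta>: "\<And>n. 0 < \<theta> n" "\<theta> \<longlonglongrightarrow> 0" and k: "k \<ge> 1"
    and p: "0 \<le> p" "p \<le> 1"
    and lim: "(\<lambda>n. h n ^ j * laplace_transform M Z (ennreal ((1 - h n ^ k) / \<theta> n))) \<longlonglongrightarrow> p"
  obtains v where "(\<lambda>n. ennreal ((1 - h n) / \<theta> n)) \<longlonglongrightarrow> v" "p = laplace_transform M Z (of_nat k * v)"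
proof -
  let ?\<phi> = "laplace_transform M Z"
  define z where "z n = (1 - h n ^ k) / \<theta> n" for n
  have z_nonneg: "0 \<le> z n" for n using h \<theta>(1)[of n] by (simp add: z_def power_le_one)
  obtain u where u: "?\<phi> u = p" using laplace_transform_surj[OF p] .
  have z_lim: "(\<lambda>n. ennreal (z n)) \<longlonglongrightarrow> u"
  proof (rule order_tendstoI)
    \<comment> \<open>The factor \<open>h ^ j\<close> is at most 1, so a product above
      \<open>?\<phi> b\<close> already forces the transform itself above that value.\<close>
    fix b assume "u < b"
    then have "?\<phi> b < p" using u by (simp add: laplace_transform_less_iff[symmetric])
    then have "eventually (\<lambda>n. ?\<phi> b < h n ^ j * ?\<phi> (ennreal (z n))) sequentially"
      using lim unfolding z_def by (rule order_tendstoD(1)[rotated])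
    then show "eventually (\<lambda>n. ennreal (z n) < b) sequentially"
    proof eventually_elim
      case (elim n)
      have "h n ^ j * ?\<phi> (ennreal (z n)) \<le> 1 * ?\<phi> (ennreal (z n))"
        using h by (intro mult_right_mono laplace_transform_nonneg) (simp add: power_le_one)
      with elim show ?case by (simp add: laplace_transform_less_iff[symmetric])
    qed
  next
    \<comment> \<open>Here the factor \<open>h ^ j\<close> could interfere. But
      \<open>z n \<le> A\<close> implies \<open>h n \<ge> 1 - A * \<theta> n\<close>, so the factor
      is nearly 1 and the product would stay too close to \<open>?\<phi> a\<close>, which exceeds
      \<open>p\<close>.\<close>
    fix a assume a: "a < u"
    then obtain A where A: "a = ennreal A" "0 \<le> A" by (cases a) auto
    have "p < ?\<phi> a" using a u by (simp add: laplace_transform_less_iff[symmetric])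
    have "(\<lambda>n. (1 - A * \<theta> n) ^ j * ?\<phi> a - h n ^ j * ?\<phi> (ennreal (z n))) \<longlonglongrightarrow> (1 - A * 0) ^ j * ?\<phi> a - p"
      using lim unfolding z_def by (intro tendsto_intros \<theta>(2))
    then have "eventually (\<lambda>n. 0 < (1 - A * \<theta> n) ^ j * ?\<phi> a - h n ^ j * ?\<phi> (ennreal (z n))) sequentially"
      using \<open>p < ?\<phi> a\<close> by (intro order_tendstoD(1)) auto
    moreover have "(\<lambda>n. A * \<theta> n) \<longlonglongrightarrow> A * 0" by (intro tendsto_intros \<theta>(2))
    then have "eventually (\<lambda>n. A * \<theta> n < 1) sequentially" by (intro order_tendstoD(2)) auto
    ultimately show "eventually (\<lambda>n. a < ennreal (z n)) sequentially"
    proof eventually_elim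
      case (elim n)
      show ?case
      proof (rule ccontr)
        assume "\<not> a < ennreal (z n)"
        then have za: "ennreal (z n) \<le> a" by simp
        then have "z n \<le> A" using A z_nonneg by simp
        then have "1 - h n ^ k \<le> A * \<theta> n" using \<theta>(1)[of n] by (simp add: z_def divide_simps)
        moreover have "h n ^ k \<le> h n ^ 1" using h k by (intro power_decreasing) auto
        ultimately have "1 - A * \<theta> n \<le> h n" by simp
        then have "(1 - A * \<theta> n) ^ j * ?\<phi> a \<le> h n ^ j * ?\<phi> (ennreal (z n))"
          using elim(2) za h(1)[of n]
          by (intro mult_mono power_mono laplace_transform_antimono laplace_transform_nonneg) auto
        then show False using elim(1) by simp
      qed
    qed
  qed
  have k0: "0 < real k" using k by simp
  show ?thesis
  proof (cases u)
    case (real b)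
    have zb: "z \<longlonglongrightarrow> b"
      using tendsto_enn2real[OF z_lim[unfolded real(2)] real(1)] z_nonneg by simp
    have "(\<lambda>n. z n * \<theta> n) \<longlonglongrightarrow> b * 0" by (intro tendsto_mult zb \<theta>(2))
    then have "(\<lambda>n. 1 - h n ^ k) \<longlonglongrightarrow> 0" using \<theta>(1) by (simp add: z_def less_imp_neq[symmetric])
    then have hk: "(\<lambda>n. h n ^ k) \<longlonglongrightarrow> 1" using tendsto_diff[OF tendsto_const[of 1]] by fastforce
    have h1: "h \<longlonglongrightarrow> 1"
    proof (rule tendsto_sandwich[OF _ _ hk tendsto_const])
      have "h n ^ k \<le> h n ^ 1" for n using h k by (intro power_decreasing) auto
      then show "\<forall>\<^sub>F n in sequentially. h n ^ k \<le> h n" by simp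
    qed (use h in simp)
    define S where "S n = (\<Sum>i<k. h n ^ i)" for n
    have "S \<longlonglongrightarrow> (\<Sum>i<k. 1 ^ i)" unfolding S_def by (intro tendsto_sum tendsto_power h1)
    then have S: "S \<longlonglongrightarrow> real k" by simp
    have S1: "1 \<le> S n" for n
    proof -
      have "(\<Sum>i\<in>{0}. h n ^ i) \<le> S n" unfolding S_def using h k by (intro sum_mono2) auto
      then show ?thesis by simp
    qed
    have "(1 - h n) / \<theta> n = z n / S n" for n
    proof -
      have "1 - h n ^ k = (1 - h n) * S n" unfolding S_def by (rule one_diff_power_eq)
      then show ?thesis using S1[of n] by (simp add: z_def)
    qed
    then have "(\<lambda>n. (1 - h n) / \<theta> n) \<longlonglongrightarrow> b / real k"
      using tendsto_divide[OF zb S] k0 by simp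
    then have "(\<lambda>n. ennreal ((1 - h n) / \<theta> n)) \<longlonglongrightarrow> ennreal (b / real k)" by (rule tendsto_ennrealI)
    moreover have "of_nat k * ennreal (b / real k) = u"
      using real k0 by (simp add: ennreal_of_nat_eq_real_of_nat ennreal_mult[symmetric])
    ultimately show ?thesis using that u by metis
  next
    case top
    \<comment> \<open>For an infinite limit the crude bound of the geometric sum by \<open>k\<close>
      suffices.\<close>
    have "z n \<le> real k * ((1 - h n) / \<theta> n)" for n
    proof -
      have "1 - h n ^ k = (1 - h n) * (\<Sum>i<k. h n ^ i)" by (rule one_diff_power_eq)
      also have "\<dots> \<le> (1 - h n) * (\<Sum>i<k. 1)"
        using h by (intro mult_left_mono sum_mono) (auto simp: power_le_one)
      finally show ?thesis using \<theta>(1)[of n] by (simp add: z_def divide_simps mult.commute)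
    qed
    then have le: "z n / real k \<le> (1 - h n) / \<theta> n" for n
      using k0 by (simp add: pos_divide_le_eq mult.commute[of _ "real k"])
    have "(\<lambda>n. ennreal (1 / real k) * ennreal (z n)) \<longlonglongrightarrow> ennreal (1 / real k) * u"
      by (intro ennreal_tendsto_cmult z_lim) simp
    moreover have "ennreal (1 / real k) * ennreal (z n) = ennreal (z n / real k)" for n
      using z_nonneg by (simp add: ennreal_mult[symmetric])
    ultimately have *: "(\<lambda>n. ennreal (z n / real k)) \<longlonglongrightarrow> top"
      using top k0 by (simp add: ennreal_mult_top)
    have "(\<lambda>n. ennreal ((1 - h n) / \<theta> n)) \<longlonglongrightarrow> top"
      by (rule tendsto_sandwich[OF _ _ * tendsto_const]) (auto intro!: always_eventually ennreal_leI le)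
    moreover have "of_nat k * top = u" using top k by (simp add: ennreal_mult_top)
    ultimately show ?thesis using that u by metis
  qed
qed

section \<open>The equivalence and the formula for the limit\<close>

text \<open>The factor \<open>of_nat k\<close> in the last clause comes from
  \<open>1 - h ^ k\<close> being asymptotic to \<open>k * (1 - h)\<close> as \<open>h\<close> tends
  to 1; for \<open>k = 1\<close> the formula is \<open>\<phi>\<close> of the exponent measure
  itself.\<close>

theorem theorem3p7:
  fixes M :: "'a measure" and Z :: "'a \<Rightarrow> real" and \<phi> :: "ennreal \<Rightarrow> real"
    and \<Theta> :: "real set" and \<theta> :: "nat \<Rightarrow> real" and j k :: nat
    and H :: "real \<Rightarrow> real^'d \<Rightarrow> real" and F :: "real^'d \<Rightarrow> real"
  assumes "CARD('d) \<ge> 2"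
    and "\<Theta> \<subseteq> {0<..}" and "0 islimpt \<Theta>"
    and "prob_space M" and "Z \<in> borel_measurable M" and "AE \<omega> in M. Z \<omega> > 0"
    and "\<phi> = laplace_transform M Z"
    and "k \<ge> 1"
    and "\<And>t. t \<in> \<Theta> \<Longrightarrow> distribution_fun (H t)"
    and "range \<theta> \<subseteq> \<Theta>" and "filterlim \<theta> (at_right 0) sequentially"
    and "distribution_fun F"
    and "\<And>y. (\<lambda>n. H (\<theta> n) y ^ j * \<phi> (ennreal ((1 - H (\<theta> n) y ^ k) / \<theta> n))) \<longlonglongrightarrow> F y"
  shows "(phi_max_inf_div \<Theta> \<phi> F \<longleftrightarrow>
           (\<exists>l \<mu>. (\<forall>i. l $ i < \<infinity>) \<and> exponent_measure l \<mu> \<and>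
              (\<forall>y. l \<le> ereal_vec y \<longrightarrow>
                 (\<lambda>n. ennreal ((1 - H (\<theta> n) y) / \<theta> n)) \<longlonglongrightarrow> emeasure \<mu> (rect_compl l y)))) \<and>
         (\<forall>l \<mu>. (\<forall>i. l $ i < \<infinity>) \<and> exponent_measure l \<mu> \<and>
              (\<forall>y. l \<le> ereal_vec y \<longrightarrow>
                 (\<lambda>n. ennreal ((1 - H (\<theta> n) y) / \<theta> n)) \<longlonglongrightarrow> emeasure \<mu> (rect_compl l y)) \<longrightarrow>
            (\<forall>y. l \<le> ereal_vec y \<longrightarrow> F y = \<phi> (of_nat k * emeasure \<mu> (rect_compl l y))))"
proof -
  interpret positive_random_variable M Z
    using assms(4-6) by (simp add: positive_random_variable_def positive_random_variable_axioms_def)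
  note \<phi> = assms(7) and k = assms(8) and F = assms(12)
  have \<theta>_in: "\<theta> n \<in> \<Theta>" for n using assms(10) by auto
  have \<theta>_pos: "0 < \<theta> n" for n using \<theta>_in[of n] assms(2) by auto
  have \<theta>_lim: "\<theta> \<longlonglongrightarrow> 0" using assms(11) by (simp add: filterlim_at)
  have H: "distribution_fun (H (\<theta> n))" for n by (rule assms(9)[OF \<theta>_in])
  note H_bounds = distribution_fun_bounds[OF H]
  have "\<exists>v. (\<lambda>n. ennreal ((1 - H (\<theta> n) y) / \<theta> n)) \<longlonglongrightarrow> v \<and> F y = \<phi> (of_nat k * v)" for y
    by (rule limit_of_rescaled_defects[OF H_bounds \<theta>_pos \<theta>_lim k distribution_fun_bounds[OF F] assms(13)[unfolded \<phi>]])
       (auto simp: \<phi>)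
  then obtain V where V: "\<And>y. (\<lambda>n. ennreal ((1 - H (\<theta> n) y) / \<theta> n)) \<longlonglongrightarrow> V y"
    and FV: "\<And>y. F y = \<phi> (of_nat k * V y)" by metis
  have k0: "0 < real k" using k by simp
  \<comment> \<open>Inverting \<open>\<phi>\<close> and dividing by \<open>k\<close> transfers
    limits of \<open>F\<close> to \<open>V\<close>: right continuity and the limits at both ends
    follow.\<close>
  have V_lim: "(\<lambda>n. V (y n)) \<longlonglongrightarrow> v" if "(\<lambda>n. F (y n)) \<longlonglongrightarrow> \<phi> (of_nat k * v)" for y v
  proof -
    have *: "(\<lambda>n. of_nat k * V (y n)) \<longlonglongrightarrow> of_nat k * v"
      using that unfolding FV \<phi> by (rule tendsto_laplace_transform_cancel)
    have "(\<lambda>n. ennreal (1 / real k) * (of_nat k * V (y n))) \<longlonglongrightarrow> ennreal (1 / real k) * (of_nat k * v)"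
      by (rule ennreal_tendsto_cmult[OF ennreal_less_top *])
    moreover have "ennreal (1 / real k) * (of_nat k * x) = x" for x
      using k0 by (simp add: mult.assoc[symmetric] ennreal_of_nat_eq_real_of_nat ennreal_mult[symmetric])
    ultimately show ?thesis by simp
  qed
  have V_cont: "(\<lambda>n. V (right_shift n y)) \<longlonglongrightarrow> V y" for y
    using distribution_fun_right_continuous[OF F, of y] FV[of y] by (intro V_lim) simp
  have V_top: "(\<lambda>n. V (\<chi> i. real n)) \<longlonglongrightarrow> 0"
    using distribution_fun_at_top[OF F] by (intro V_lim) (simp add: \<phi>)
  have V_bot: "(\<lambda>n. V (\<chi> j. if j = i then - real n else y $ j)) \<longlonglongrightarrow> top" for i y
    using distribution_fun_at_bot[OF F, of i y] k by (intro V_lim) (simp add: \<phi> ennreal_mult_top)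
  \<comment> \<open>All exponents are treated at once: \<open>\<tau> = k\<close> gives the
    max-infinitely divisible function, \<open>\<tau> = k / n\<close> its roots, and
    \<open>\<tau> = 1\<close> the distribution function of the exponent measure.\<close>
  have df: "distribution_fun (\<lambda>y. exp_neg (ennreal \<tau> * V y))" if \<tau>: "0 < \<tau>" for \<tau>
  proof (rule distribution_fun_limit)
    show "distribution_fun (\<lambda>y. H (\<theta> n) y ^ Suc (nat \<lfloor>\<tau> / \<theta> n\<rfloor>))" for n
      by (rule distribution_fun_power_Suc[OF H])
    show "(\<lambda>n. H (\<theta> n) y ^ Suc (nat \<lfloor>\<tau> / \<theta> n\<rfloor>)) \<longlonglongrightarrow> exp_neg (ennreal \<tau> * V y)" for y
      by (rule power_Suc_floor_tendsto_exp_neg[OF H_bounds \<theta>_pos \<theta>_lim \<tau> V])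
    show "(\<lambda>n. exp_neg (ennreal \<tau> * V (right_shift n y))) \<longlonglongrightarrow> exp_neg (ennreal \<tau> * V y)" for y
      by (intro tendsto_exp_neg ennreal_tendsto_cmult V_cont) simp
    have "(\<lambda>n. exp_neg (ennreal \<tau> * V (\<chi> i. real n))) \<longlonglongrightarrow> exp_neg (ennreal \<tau> * 0)"
      by (intro tendsto_exp_neg ennreal_tendsto_cmult V_top) simp
    then show "(\<lambda>n. exp_neg (ennreal \<tau> * V (\<chi> i. real n))) \<longlonglongrightarrow> 1" by (simp add: exp_neg_def)
    fix y :: "real^'d" and i
    have "(\<lambda>n. exp_neg (ennreal \<tau> * V (\<chi> j. if j = i then - real n else y $ j))) \<longlonglongrightarrow> exp_neg (ennreal \<tau> * top)"
      by (intro tendsto_exp_neg ennreal_tendsto_cmult V_bot) simp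
    then show "(\<lambda>n. exp_neg (ennreal \<tau> * V (\<chi> j. if j = i then - real n else y $ j))) \<longlonglongrightarrow> 0"
      using \<tau> by (simp add: ennreal_mult_top)
  qed
  have neg_log_exp_neg: "neg_log (exp_neg v) = v" for v
    by (cases v) (auto simp: neg_log_def exp_neg_def)
  have "phi_max_inf_div \<Theta> \<phi> F"
    unfolding phi_max_inf_div_def
  proof (intro conjI F exI)
    \<comment> \<open>The given family and sequence serve as witnesses, with \<open>?P\<close> the
      generating function already present in the assumed limit.\<close>
    let ?P = "\<lambda>t s. s ^ j * \<phi> (ennreal ((1 - s ^ k) / t))"
    let ?G = "\<lambda>y. exp_neg (of_nat k * V y)"
    show "\<forall>t\<in>\<Theta>. distribution_fun (H t) \<and> prob_gen_fun (?P t)"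
      using assms(2,9) unfolding \<phi> by (auto intro!: prob_gen_fun_laplace_transform)
    show "max_inf_div ?G"
      unfolding max_inf_div_def
    proof (intro conjI allI impI)
      show "distribution_fun ?G" using df[OF k0] by (simp add: ennreal_of_nat_eq_real_of_nat)
      fix n :: nat assume n: "1 \<le> n"
      have "exp_neg (of_nat k * v) powr (1 / real n) = exp_neg (ennreal (real k / real n) * v)" for v
      proof (cases v)
        case (real b)
        then show ?thesis
          by (simp add: ennreal_of_nat_eq_real_of_nat ennreal_mult[symmetric] exp_neg_ennreal powr_def)
      next
        case top
        then show ?thesis using n k by (simp add: ennreal_mult_top)
      qed
      then show "distribution_fun (\<lambda>y. ?G y powr (1 / real n))" using df[of "real k / real n"] k0 n by simp
    qed
    show "\<forall>y. F y = \<phi> (neg_log (?G y))" by (simp add: neg_log_exp_neg FV)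
    show "range \<theta> \<subseteq> \<Theta>" "filterlim \<theta> (at_right 0) sequentially" by fact+
    show "\<forall>y. (\<lambda>n. ?P (\<theta> n) (H (\<theta> n) y)) \<longlonglongrightarrow> F y" using assms(13) by simp
  qed
  moreover have "\<exists>l \<mu>. (\<forall>i. l $ i < \<infinity>) \<and> exponent_measure l \<mu> \<and>
              (\<forall>y. l \<le> ereal_vec y \<longrightarrow>
                 (\<lambda>n. ennreal ((1 - H (\<theta> n) y) / \<theta> n)) \<longlonglongrightarrow> emeasure \<mu> (rect_compl l y))"
  proof -
    obtain N where N: "\<And>n. prob_space (N n)" "\<And>n. sets (N n) = sets borel"
      "\<And>n y. H (\<theta> n) y = measure (N n) {x. x \<le> y}"
      using H unfolding distribution_fun_def by metis
    \<comment> \<open>A point where \<open>V\<close> is finite is needed to keep the bottom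
      \<open>l\<close> below \<open>\<infinity>\<close>.\<close>
    have "eventually (\<lambda>n. V (\<chi> i. real n) < top) sequentially"
      using V_top by (rule order_tendstoD) simp
    then obtain n :: nat where fin: "V (\<chi> i. real n) < \<infinity>" by (auto simp: eventually_sequentially)
    obtain l \<mu> where l: "\<And>i. l $ i < \<infinity>"
      "sets \<mu> = sets (restrict_space borel ({x. l \<le> x} - {l}))"
      "\<And>K. compact K \<Longrightarrow> K \<subseteq> {x. l \<le> x} - {l} \<Longrightarrow> emeasure \<mu> K < \<infinity>"
      "\<And>y. l \<le> ereal_vec y \<Longrightarrow> emeasure \<mu> (rect_compl l y) = V y"
      "\<And>y. \<not> l \<le> ereal_vec y \<Longrightarrow> V y = \<infinity>"
    proof (rule exponent_measure_exists[of N "\<lambda>n. 1 / \<theta> n" V])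
      show "(\<lambda>n. ennreal (1 / \<theta> n * (1 - measure (N n) {x. x \<le> y}))) \<longlonglongrightarrow> V y" for y
        using V[of y] by (simp add: N(3))
    qed (use N V_cont fin \<theta>_pos in \<open>auto simp: less_imp_le\<close>)
    \<comment> \<open>Outside the rectangle above \<open>l\<close> both sides are 0, because
      \<open>V\<close> is infinite there.\<close>
    have "(\<lambda>y. if l \<le> ereal_vec y then exp_neg (emeasure \<mu> (rect_compl l y)) else 0) = (\<lambda>y. exp_neg (ennreal 1 * V y))"
      using l(4,5) by (auto simp: fun_eq_iff)
    then have "exponent_measure l \<mu>"
      unfolding exponent_measure_def using df[of 1] l(2,3) by simp
    then show ?thesis using l(1,4) V by (intro exI[of _ l] exI[of _ \<mu>]) auto
  qed
  moreover have "F y = \<phi> (of_nat k * emeasure \<mu> (rect_compl l y))"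
    if "(\<lambda>n. ennreal ((1 - H (\<theta> n) y) / \<theta> n)) \<longlonglongrightarrow> emeasure \<mu> (rect_compl l y)" for l \<mu> y
    using LIMSEQ_unique[OF that V] FV by simp
  ultimately show ?thesis by blast
qed

end
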